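(* Let $r,n\in\mathbb{N}$, let $c_1,\ldots,c_r$ be pairwise distinct real numbers, let $j=\mathrm{diag}\{I_{m_1},-I_{m_2}\}$ with $m_1,m_2\in\mathbb{N}\cup\{0\}$, $m=m_1+m_2>0$, and let $\beta_k(x)$ ($1\le k\le r$) be $p\times m$ matrix functions ($p\le m$) on an interval $\mathcal I\ni0$ such that $H_k(x)=\beta_k(x)^*\beta_k(x)$ are locally summable. Let a triple $\{A,S(0),\Pi(0)\}$ with $A,S(0)\in\mathbb{C}^{n\times n}$, $\Pi(0)\in\mathbb{C}^{n\times m}$ satisfy $c_k\notin\sigma(A)$ for $1\le k\le r$ and $$AS(0)-S(0)A^*=\mathrm{i}\,\Pi(0)j\Pi(0)^*,\qquad S(0)=S(0)^*,$$ and let $\Pi(x)$, $S(x)$ (with these initial values) satisfy on $\mathcal I$ $$\Pi'(x)=-\mathrm{i}\sum_{k=1}^r(A-c_kI_n)^{-1}\Pi(x)jH_k(x),$$ $$S'(x)=-\sum_{k=1}^r(A-c_kI_n)^{-1}\Pi(x)jH_k(x)j\Pi(x)^*(A^*-c_kI_n)^{-1}.$$ Then, at the points of invertibility of $S(x)$, the $m\times n$ matrix function $$\widetilde\psi(x,\zeta_1,\ldots,\zeta_r)=j\Pi(x)^*S(x)^{-1}\exp\Big\{\sum_{k=1}^r\zeta_k(A-c_kI_n)^{-1}\Big\}$$ of $x$ and the real variables $\zeta_1,\ldots,\zeta_r$ satisfies the system $$\frac{\partial\widetilde\psi}{\partial x}=\mathrm{i}\sum_{k=1}^rj\widetilde H_k(x)\frac{\partial\widetilde\psi}{\partial\zeta_k},$$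 where $$\widetilde H_k(x)=\widetilde\beta_k(x)^*\widetilde\beta_k(x),\quad \widetilde\beta_k(x)=\beta_k(x)\,j\,w_A(x,c_k)^*j,\quad w_A(x,z)=I_m-\mathrm{i}\,j\Pi(x)^*S(x)^{-1}(A-zI_n)^{-1}\Pi(x).$$
   Context: $'$ denotes $d/dx$; since the coefficients $H_k$ are only locally summable, the differential equations in $x$ are understood for absolutely continuous matrix functions and almost everywhere in $x$. $I_q$ is the $q\times q$ identity, $M^*$ the conjugate transpose, $\sigma(A)$ the spectrum of $A$. *)

theory Defs
  imports "HOL-Analysis.Analysis"
begin

text \<open>Throughout, \<^typ>\<open>complex^'b^'a\<close> is the type of complex matrices whose rows are indexed by
  \<^typ>\<open>'a\<close> and whose columns are indexed by \<^typ>\<open>'b\<close>.\<close>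

definition ctranspose :: "complex^'b^'a \<Rightarrow> complex^'a^'b"  ("(_\<^sup>\<dagger>)" [1000] 999)
  where "M\<^sup>\<dagger> = map_matrix cnj (transpose M)"

definition cscale :: "complex \<Rightarrow> complex^'b^'a \<Rightarrow> complex^'b^'a"  (infixr "*\<^sub>C" 75)
  where "z *\<^sub>C M = map_matrix (\<lambda>w. z * w) M"

definition spectrum :: "complex^'n^'n \<Rightarrow> complex set"
  where "spectrum A = {z. \<not> invertible (A - mat z)}"

text \<open>The library operations \<open>*\<close> and \<open>^\<close> on vectors and matrices act componentwise, so powers with
  respect to the matrix product are introduced separately.\<close>

primrec matpow :: "complex^'n^'n \<Rightarrow> nat \<Rightarrow> complex^'n^'n"
  where
    "matpow A 0 = mat 1"
  | "matpow A (Suc k) = A ** matpow A k"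

definition matexp :: "complex^'n^'n \<Rightarrow> complex^'n^'n"
  where "matexp A = (\<Sum>k. (1 / fact k) *\<^sub>R matpow A k)"

text \<open>The block matrix \<open>diag {I, -I}\<close> with blocks of sizes \<open>m1\<close> and \<open>CARD('m) - m1\<close>. The linear order
  of the index type says which indices are the first \<open>m1\<close> ones: \<open>card {i. i < a}\<close> is the
  position of \<open>a\<close>, counted from zero.\<close>

definition sigmat :: "nat \<Rightarrow> complex^('m::{finite,linorder})^('m::{finite,linorder})"
  where "sigmat m1 = (\<chi> a b. if a \<noteq> b then 0 else if card {i. i < a} < m1 then 1 else -1)"

text \<open>The finite set \<open>D\<close> consists of the pairs of endpoints of non-overlapping compact intervals.\<close>

definition abs_continuous_on :: "real set \<Rightarrow> (real \<Rightarrow> 'a::real_normed_vector) \<Rightarrow> bool"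
  where "abs_continuous_on X f \<longleftrightarrow>
    (\<forall>\<epsilon>>0. \<exists>\<delta>>0. \<forall>D :: (real \<times> real) set.
       finite D \<and> (\<forall>(a,b)\<in>D. a \<le> b \<and> {a..b} \<subseteq> X) \<and>
       pairwise (\<lambda>(a,b) (a',b'). {a<..<b} \<inter> {a'<..<b'} = {}) D \<and>
       (\<Sum>(a,b)\<in>D. b - a) < \<delta>
       \<longrightarrow> (\<Sum>(a,b)\<in>D. norm (f b - f a)) < \<epsilon>)"

definition locally_abs_continuous_on :: "real set \<Rightarrow> (real \<Rightarrow> 'a::real_normed_vector) \<Rightarrow> bool"
  where "locally_abs_continuous_on X f \<longleftrightarrow>
    (\<forall>a b. {a..b} \<subseteq> X \<longrightarrow> abs_continuous_on {a..b} f)"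

definition locally_summable_on :: "(real \<Rightarrow> 'a::euclidean_space) \<Rightarrow> real set \<Rightarrow> bool"
  where "locally_summable_on f X \<longleftrightarrow>
    (\<forall>a b. {a..b} \<subseteq> X \<longrightarrow> f absolutely_integrable_on {a..b})"

text \<open>In the next three definitions \<open>S\<close>, \<open>P\<close> and \<open>B\<close> stand for the values \<open>S(x)\<close>, \<open>\<Pi>(x)\<close> and
  \<open>\<beta>\<^sub>k(x)\<close> at one point \<open>x\<close>, and \<open>j\<close> stands for the signature matrix.\<close>

definition transfer_mat ::
    "complex^'m^'m \<Rightarrow> complex^'n^'n \<Rightarrow> complex^'n^'n \<Rightarrow> complex^'m^'n \<Rightarrow> complex \<Rightarrow> complex^'m^'m"
  where "transfer_mat j A S P z =
    mat 1 - \<i> *\<^sub>C (j ** P\<^sup>\<dagger> ** matrix_inv S ** matrix_inv (A - mat z) ** P)"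

definition beta_tilde ::
    "complex^'m^'m \<Rightarrow> complex^'n^'n \<Rightarrow> complex^'n^'n \<Rightarrow> complex^'m^'n \<Rightarrow> real \<Rightarrow> complex^'m^'p
      \<Rightarrow> complex^'m^'p"
  where "beta_tilde j A S P ck B = B ** j ** (transfer_mat j A S P (complex_of_real ck))\<^sup>\<dagger> ** j"

definition psi_tilde ::
    "complex^'m^'m \<Rightarrow> nat \<Rightarrow> (nat \<Rightarrow> real) \<Rightarrow> complex^'n^'n \<Rightarrow> complex^'n^'n \<Rightarrow> complex^'m^'n
      \<Rightarrow> (nat \<Rightarrow> real) \<Rightarrow> complex^'n^'m"
  where "psi_tilde j r c A S P \<zeta> =
    j ** P\<^sup>\<dagger> ** matrix_inv S **
      matexp (\<Sum>k=1..r. \<zeta> k *\<^sub>R matrix_inv (A - mat (complex_of_real (c k))))"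

end

theory Submission
  imports Defs
begin

text \<open>
  Write \<open>R\<^sub>k\<close> for the resolvent \<open>(A - c\<^sub>k)\<^sup>-\<^sup>1\<close>, \<open>w\<^sub>k\<close> for the value at \<open>c\<^sub>k\<close> of the transfer matrix
  function and \<open>E(\<zeta>)\<close> for the exponential factor, so that \<open>\<psi> = j P\<^sup>\<dagger> S\<^sup>-\<^sup>1 E(\<zeta>)\<close>.
  The resolvents commute with each other, hence differentiating in \<open>\<zeta>\<^sub>k\<close> only inserts a factor
  \<open>R\<^sub>k\<close> before \<open>E(\<zeta>)\<close> (\<open>has_vector_derivative_matexp\<close>). The exponential does not depend
  on \<open>x\<close>, so the system is equivalent to the matrix identity
  \<open>(P\<^sup>\<dagger> S\<^sup>-\<^sup>1)' = \<i> \<Sum>\<^sub>k Ht\<^sub>k j P\<^sup>\<dagger> S\<^sup>-\<^sup>1 R\<^sub>k\<close>.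

  The product rule and the two given equations express the left-hand side as a sum over \<open>k\<close> of
  \<open>\<i> (1 - \<i> P\<^sup>\<dagger> S\<^sup>-\<^sup>1 R\<^sub>k P j) H\<^sub>k j P\<^sup>\<dagger> R\<^sub>k\<^sup>\<dagger> S\<^sup>-\<^sup>1\<close>. The bracket is \<open>j w\<^sub>k j\<close>, and
  \<open>Ht\<^sub>k = j w\<^sub>k j H\<^sub>k j w\<^sub>k\<^sup>\<dagger> j\<close>, so the terms agree one by one
  (\<open>dressed_weight_identity\<close>) as soon as
  \<open>w\<^sub>k\<^sup>\<dagger> P\<^sup>\<dagger> S\<^sup>-\<^sup>1 R\<^sub>k = P\<^sup>\<dagger> R\<^sub>k\<^sup>\<dagger> S\<^sup>-\<^sup>1\<close> (\<open>transfer_mat_intertwines\<close>). This relation is a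
  consequence of \<open>S = S\<^sup>\<dagger>\<close> and of the operator identity \<open>A S - S A\<^sup>\<dagger> = \<i> P j P\<^sup>\<dagger>\<close>.

  These two facts are given at one point only and have to be carried along the interval: the
  differential equations make the derivatives of \<open>S - S\<^sup>\<dagger>\<close> and of
  \<open>A S - S A\<^sup>\<dagger> - \<i> P j P\<^sup>\<dagger>\<close> vanish almost everywhere (\<open>operator_identity_preserved\<close>), and an
  absolutely continuous function with this property is constant
  (\<open>abs_continuous_on_zero_derivative_const\<close>). The remaining work is calculus: products,
  linear images and inverses of absolutely continuous matrix functions are absolutely continuous,
  and the inverse and the exponential have the expected derivatives.
\<close>

section \<open>Absolutely continuous functions\<close>

text \<open>The increments over the intervals of any finite family are dominated term by term, so a
  \<open>\<delta>\<close> that serves both \<open>f\<close> and \<open>g\<close> serves \<open>h\<close> as well. All closure properties below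
  are instances: it only remains to estimate a single increment.\<close>
lemma abs_continuous_on_dominated:
  fixes f :: "real \<Rightarrow> 'a::real_normed_vector" and g :: "real \<Rightarrow> 'b::real_normed_vector"
    and h :: "real \<Rightarrow> 'c::real_normed_vector"
  assumes f: "abs_continuous_on X f" and g: "abs_continuous_on X g"
    and le: "\<And>x y. x \<in> X \<Longrightarrow> y \<in> X \<Longrightarrow>
               norm (h y - h x) \<le> L * (norm (f y - f x) + norm (g y - g x))"
  shows "abs_continuous_on X h"
  unfolding abs_continuous_on_def
proof (intro allI impI)
  fix \<epsilon> :: real assume "\<epsilon> > 0"
  define e where "e = \<epsilon> / (2 * (\<bar>L\<bar> + 1))"
  have e: "e > 0" using \<open>\<epsilon> > 0\<close> by (simp add: e_def add_nonneg_pos)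
  from f e obtain d1 where "d1 > 0" and d1: "\<And>D :: (real \<times> real) set. finite D \<Longrightarrow>
       (\<forall>(a,b)\<in>D. a \<le> b \<and> {a..b} \<subseteq> X) \<Longrightarrow>
       pairwise (\<lambda>(a,b) (a',b'). {a<..<b} \<inter> {a'<..<b'} = {}) D \<Longrightarrow>
       (\<Sum>(a,b)\<in>D. b - a) < d1 \<Longrightarrow> (\<Sum>(a,b)\<in>D. norm (f b - f a)) < e"
    unfolding abs_continuous_on_def by meson
  from g e obtain d2 where "d2 > 0" and d2: "\<And>D :: (real \<times> real) set. finite D \<Longrightarrow>
       (\<forall>(a,b)\<in>D. a \<le> b \<and> {a..b} \<subseteq> X) \<Longrightarrow>
       pairwise (\<lambda>(a,b) (a',b'). {a<..<b} \<inter> {a'<..<b'} = {}) D \<Longrightarrow>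
       (\<Sum>(a,b)\<in>D. b - a) < d2 \<Longrightarrow> (\<Sum>(a,b)\<in>D. norm (g b - g a)) < e"
    unfolding abs_continuous_on_def by meson
  show "\<exists>\<delta>>0. \<forall>D :: (real \<times> real) set.
       finite D \<and> (\<forall>(a,b)\<in>D. a \<le> b \<and> {a..b} \<subseteq> X) \<and>
       pairwise (\<lambda>(a,b) (a',b'). {a<..<b} \<inter> {a'<..<b'} = {}) D \<and>
       (\<Sum>(a,b)\<in>D. b - a) < \<delta>
       \<longrightarrow> (\<Sum>(a,b)\<in>D. norm (h b - h a)) < \<epsilon>"
  proof (intro exI[of _ "min d1 d2"] conjI allI impI)
    show "min d1 d2 > 0" using \<open>d1 > 0\<close> \<open>d2 > 0\<close> by simp
    fix D :: "(real \<times> real) set"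
    assume "finite D \<and> (\<forall>(a,b)\<in>D. a \<le> b \<and> {a..b} \<subseteq> X) \<and>
       pairwise (\<lambda>(a,b) (a',b'). {a<..<b} \<inter> {a'<..<b'} = {}) D \<and>
       (\<Sum>(a,b)\<in>D. b - a) < min d1 d2"
    then have D: "finite D" "\<forall>(a,b)\<in>D. a \<le> b \<and> {a..b} \<subseteq> X"
       "pairwise (\<lambda>(a,b) (a',b'). {a<..<b} \<inter> {a'<..<b'} = {}) D"
       "(\<Sum>(a,b)\<in>D. b - a) < d1" "(\<Sum>(a,b)\<in>D. b - a) < d2" by auto
    have "(\<Sum>(a,b)\<in>D. norm (h b - h a)) \<le>
            (\<Sum>(a,b)\<in>D. (\<bar>L\<bar> + 1) * (norm (f b - f a) + norm (g b - g a)))"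
    proof (rule sum_mono, clarify)
      fix a b assume "(a, b) \<in> D"
      then have "a \<le> b" "{a..b} \<subseteq> X" using D(2) by auto
      then have "a \<in> X" "b \<in> X" by auto
      then have "norm (h b - h a) \<le> L * (norm (f b - f a) + norm (g b - g a))"
        by (rule le)
      also have "\<dots> \<le> (\<bar>L\<bar> + 1) * (norm (f b - f a) + norm (g b - g a))"
        by (rule mult_right_mono) auto
      finally show "norm (h b - h a) \<le> (\<bar>L\<bar> + 1) * (norm (f b - f a) + norm (g b - g a))" .
    qed
    also have "\<dots> = (\<bar>L\<bar> + 1) * ((\<Sum>(a,b)\<in>D. norm (f b - f a)) + (\<Sum>(a,b)\<in>D. norm (g b - g a)))"
      by (simp add: sum.distrib[symmetric] sum_distrib_left case_prod_unfold)
    also have "\<dots> < (\<bar>L\<bar> + 1) * (e + e)"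
      using d1[OF D(1-4)] d2[OF D(1-3,5)] by (intro mult_strict_left_mono add_strict_mono) auto
    also have "\<dots> = \<epsilon>" by (simp add: e_def field_simps add_nonneg_eq_0_iff)
    finally show "(\<Sum>(a,b)\<in>D. norm (h b - h a)) < \<epsilon>" .
  qed
qed

lemma abs_continuous_on_imp_continuous_on:
  fixes f :: "real \<Rightarrow> 'a::real_normed_vector"
  assumes f: "abs_continuous_on {a..b} f"
  shows "continuous_on {a..b} f"
  unfolding continuous_on_iff
proof (intro ballI allI impI)
  fix x e :: real assume x: "x \<in> {a..b}" and "e > 0"
  with f obtain d where "d > 0" and d: "\<And>D :: (real \<times> real) set. finite D \<Longrightarrow>
       (\<forall>(u,v)\<in>D. u \<le> v \<and> {u..v} \<subseteq> {a..b}) \<Longrightarrow>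
       pairwise (\<lambda>(a,b) (a',b'). {a<..<b} \<inter> {a'<..<b'} = {}) D \<Longrightarrow>
       (\<Sum>(a,b)\<in>D. b - a) < d \<Longrightarrow> (\<Sum>(a,b)\<in>D. norm (f b - f a)) < e"
    unfolding abs_continuous_on_def by meson
  have "dist (f y) (f x) < e" if y: "y \<in> {a..b}" "dist y x < d" for y
    using d[of "{(min x y, max x y)}"] x y
    by (cases "x \<le> y") (auto simp: dist_norm norm_minus_commute)
  then show "\<exists>d>0. \<forall>y\<in>{a..b}. dist y x < d \<longrightarrow> dist (f y) (f x) < e"
    using \<open>d > 0\<close> by blast
qed

lemma abs_continuous_on_bounded_linear:
  assumes "bounded_linear T" and f: "abs_continuous_on X f"
  shows "abs_continuous_on X (\<lambda>x. T (f x))"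
proof -
  interpret bounded_linear T by fact
  obtain K where K: "\<And>x. norm (T x) \<le> norm x * K" using bounded by blast
  show ?thesis
  proof (rule abs_continuous_on_dominated[OF f f])
    fix x y
    show "norm (T (f y) - T (f x)) \<le> (K / 2) * (norm (f y - f x) + norm (f y - f x))"
      using K[of "f y - f x"] by (simp add: diff mult.commute)
  qed
qed

lemma abs_continuous_on_diff:
  assumes f: "abs_continuous_on X f" and g: "abs_continuous_on X g"
  shows "abs_continuous_on X (\<lambda>x. f x - g x)"
proof (rule abs_continuous_on_dominated[OF f g])
  fix x y
  have "f y - g y - (f x - g x) = (f y - f x) - (g y - g x)" by simp
  then show "norm (f y - g y - (f x - g x)) \<le> 1 * (norm (f y - f x) + norm (g y - g x))"
    by (metis mult_1 norm_triangle_ineq4)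
qed

lemma abs_continuous_on_bounded_bilinear:
  assumes "bounded_bilinear B"
    and f: "abs_continuous_on {a..b} f" and g: "abs_continuous_on {a..b} g"
  shows "abs_continuous_on {a..b} (\<lambda>x. B (f x) (g x))"
proof -
  interpret bounded_bilinear B by fact
  obtain K where "K > 0" and K: "\<And>x y. norm (B x y) \<le> norm x * norm y * K"
    using pos_bounded by blast
  have "bounded (f ` {a..b})" "bounded (g ` {a..b})"
    using f g by (auto intro!: compact_imp_bounded compact_continuous_image
        abs_continuous_on_imp_continuous_on)
  then obtain M N where M: "\<And>x. x \<in> {a..b} \<Longrightarrow> norm (f x) \<le> M"
    and N: "\<And>x. x \<in> {a..b} \<Longrightarrow> norm (g x) \<le> N"
    unfolding bounded_iff by (metis image_eqI)
  show ?thesis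
  proof (rule abs_continuous_on_dominated[OF f g])
    fix x y assume x: "x \<in> {a..b}" and y: "y \<in> {a..b}"
    have MN: "0 \<le> M" "0 \<le> N" using M[OF x] N[OF x] norm_ge_zero order_trans by blast+
    have "B (f y) (g y) - B (f x) (g x) = B (f y) (g y - g x) + B (f y - f x) (g x)"
      by (simp add: diff_left diff_right)
    also have "norm \<dots> \<le> norm (f y) * norm (g y - g x) * K + norm (f y - f x) * norm (g x) * K"
      by (rule norm_triangle_le[OF add_mono[OF K K]])
    also have "\<dots> \<le> (M + N) * norm (g y - g x) * K + norm (f y - f x) * (M + N) * K"
      using M[OF y] N[OF x] MN \<open>K > 0\<close>
      by (intro add_mono mult_right_mono mult_left_mono) auto
    also have "\<dots> = ((M + N) * K) * (norm (f y - f x) + norm (g y - g x))"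
      by (simp add: algebra_simps)
    finally show "norm (B (f y) (g y) - B (f x) (g x))
        \<le> ((M + N) * K) * (norm (f y - f x) + norm (g y - g x))" .
  qed
qed

text \<open>The proof uses a gauge instead of a covering theorem. Cover the null set \<open>N\<close> where the
  derivative is not known to vanish by an open set \<open>T\<close> of measure less than \<open>\<delta>\<close>, and take a
  tagged division of the interval so fine that a cell with tag in \<open>N\<close> lies inside \<open>T\<close>,
  while on a cell with any other tag the increment of \<open>f\<close> is at most \<open>e\<close> times the length.
  The cells of the first kind have total length less than \<open>\<delta>\<close>, so absolute continuity bounds
  their contribution by \<open>e\<close>; those of the second kind contribute at most \<open>e (b - a)\<close>.\<close>
lemma abs_continuous_on_zero_derivative_const:
  fixes f :: "real \<Rightarrow> 'a::real_normed_vector"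
  assumes "a \<le> b" and ac: "abs_continuous_on {a..b} f"
    and deriv: "AE x\<in>{a..b} in lebesgue. (f has_vector_derivative 0) (at x within {a..b})"
  shows "f b = f a"
proof -
  have small: "norm (f b - f a) \<le> e * (b - a) + e" if "e > 0" for e :: real
  proof -
    obtain d where "d > 0" and d: "\<And>D :: (real \<times> real) set. finite D \<Longrightarrow>
       (\<forall>(u,v)\<in>D. u \<le> v \<and> {u..v} \<subseteq> {a..b}) \<Longrightarrow>
       pairwise (\<lambda>(a,b) (a',b'). {a<..<b} \<inter> {a'<..<b'} = {}) D \<Longrightarrow>
       (\<Sum>(a,b)\<in>D. b - a) < d \<Longrightarrow> (\<Sum>(a,b)\<in>D. norm (f b - f a)) < e"
      using ac \<open>e > 0\<close> unfolding abs_continuous_on_def by meson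
    from AE_E[OF deriv] obtain N where sub: "{x \<in> space lebesgue. \<not> (x \<in> {a..b} \<longrightarrow>
        (f has_vector_derivative 0) (at x within {a..b}))} \<subseteq> N"
      and N: "emeasure lebesgue N = 0" "N \<in> sets lebesgue" by blast
    obtain T where T: "open T" "N \<subseteq> T" "T - N \<in> lmeasurable" "emeasure lebesgue (T - N) < ennreal d"
      using sets_lebesgue_outer_open[OF N(2) \<open>d > 0\<close>] by metis
    have Nnull: "N \<in> null_sets lebesgue" using N by auto
    have "emeasure lebesgue T = emeasure lebesgue (T - N)"
      using emeasure_Diff_null_set[OF Nnull] T(1) by (simp add: borel_open)
    with T(4) have emT: "emeasure lebesgue T < ennreal d" by simp
    have Tm: "T \<in> lmeasurable"
      using T(1) emT by (auto simp: fmeasurable_def borel_open intro: less_trans)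
    have mT: "measure lebesgue T < d"
      using emT \<open>d > 0\<close> by (simp add: emeasure_eq_measure2[OF Tm] ennreal_less_iff)
    have "\<exists>r>0. (x \<in> N \<longrightarrow> ball x r \<subseteq> T) \<and>
        (x \<in> {a..b} - N \<longrightarrow> (\<forall>y\<in>{a..b}. \<bar>y - x\<bar> < r \<longrightarrow> norm (f y - f x) \<le> e * \<bar>y - x\<bar>))" for x
    proof -
      consider "x \<in> N" | "x \<in> {a..b} - N" | "x \<notin> N" "x \<notin> {a..b}" by blast
      then show ?thesis
      proof cases
        case 1
        then show ?thesis using T(1,2) by (meson DiffE openE subsetD)
      next
        case 2
        with sub have "(f has_vector_derivative 0) (at x within {a..b})" by auto
        then have "(f has_derivative (\<lambda>_. 0)) (at x within {a..b})"
          by (simp add: has_vector_derivative_def)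
        then show ?thesis using 2 \<open>e > 0\<close> unfolding has_derivative_within_alt by force
      next
        case 3
        then show ?thesis by (intro exI[of _ 1]) auto
      qed
    qed
    then obtain r where r: "\<And>x. r x > 0" "\<And>x. x \<in> N \<Longrightarrow> ball x (r x) \<subseteq> T"
      "\<And>x y. x \<in> {a..b} - N \<Longrightarrow> y \<in> {a..b} \<Longrightarrow> \<bar>y - x\<bar> < r x \<Longrightarrow> norm (f y - f x) \<le> e * \<bar>y - x\<bar>"
      by metis
    have "gauge (\<lambda>x. ball x (r x))" using r(1) by (simp add: gauge_def)
    then obtain p where p: "p tagged_division_of {a..b}" and fine: "(\<lambda>x. ball x (r x)) fine p"
      using fine_division_exists_real by blast
    note pD = tagged_division_ofD[OF p]
    have cell: "\<exists>u v. K = {u..v} \<and> u \<le> x \<and> x \<le> v \<and> a \<le> u \<and> v \<le> b \<and> {u..v} \<subseteq> ball x (r x)"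
      if xK: "(x, K) \<in> p" for x K
    proof -
      obtain u v where K: "K = {u..v}" using pD(4)[OF xK] by (auto simp: cbox_interval)
      have "x \<in> {u..v}" "{u..v} \<subseteq> {a..b}" using pD(2,3)[OF xK] K by auto
      moreover have "{u..v} \<subseteq> ball x (r x)" using fineD[OF fine xK] K by simp
      ultimately show ?thesis using K by auto
    qed
    \<comment> \<open>The cells in \<open>p1\<close> are controlled by absolute continuity, those in \<open>p2\<close> by the derivative.\<close>
    define p1 where "p1 = {(x, K) \<in> p. x \<in> N}"
    define p2 where "p2 = {(x, K) \<in> p. x \<notin> N}"
    have p12: "p = p1 \<union> p2" "p1 \<inter> p2 = {}" and fin: "finite p1" "finite p2"
      using pD(1) by (auto simp: p1_def p2_def intro: finite_subset)
    let ?G = "\<lambda>K. norm (f (Sup K) - f (Inf K))"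
    have part: "p1 tagged_partial_division_of {a..b}"
      by (rule tagged_partial_division_subset[of p]) (use p p1_def in \<open>auto simp: tagged_division_of_def\<close>)
    have div: "snd ` p1 division_of \<Union>(snd ` p1)"
      by (rule partial_division_of_tagged_division[OF part])
    let ?D = "(\<lambda>K. (Inf K, Sup K)) ` (snd ` p1)"
    have cell1: "\<exists>u v. K = {u..v} \<and> u \<le> v \<and> a \<le> u \<and> v \<le> b \<and> {u..v} \<subseteq> T"
      if "K \<in> snd ` p1" for K
    proof -
      from that obtain x where x: "(x, K) \<in> p" "x \<in> N" by (auto simp: p1_def)
      obtain u v where "K = {u..v}" "u \<le> x" "x \<le> v" "a \<le> u" "v \<le> b" "{u..v} \<subseteq> ball x (r x)"
        using cell[OF x(1)] by blast
      then show ?thesis using r(2)[OF x(2)] by (intro exI[of _ u] exI[of _ v]) auto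
    qed
    have inj: "inj_on (\<lambda>K. (Inf K, Sup K)) (snd ` p1)"
    proof (rule inj_onI)
      fix K L assume K: "K \<in> snd ` p1" and L: "L \<in> snd ` p1" and eq: "(Inf K, Sup K) = (Inf L, Sup L)"
      have "K = {Inf K..Sup K}" "L = {Inf L..Sup L}" using cell1[OF K] cell1[OF L] by auto
      then show "K = L" using eq by auto
    qed
    have bad: "(\<Sum>(x,K)\<in>p1. ?G K) < e"
    proof -
      have "(\<Sum>K\<in>snd ` p1. ?G K) = sum (?G \<circ> snd) p1"
      \<comment> \<open>Two tags may share a cell only if the cell is a single point; then its increment is \<open>0\<close>.\<close>
      proof (rule sum.reindex_nontrivial[OF fin(1)])
        fix s t assume s: "s \<in> p1" and t: "t \<in> p1" "s \<noteq> t" "snd s = snd t"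
        then have "interior (snd s) \<inter> interior (snd t) = {}"
          using tagged_partial_division_ofD(5)[OF part, of "fst s" "snd s" "fst t" "snd t"]
          by (metis prod.collapse)
        then have "interior (snd s) = {}" using t by simp
        moreover obtain u v where "snd s = {u..v}" "u \<le> v" using cell1[of "snd s"] s by blast
        ultimately show "?G (snd s) = 0" by (simp add: interior_atLeastAtMost_real)
      qed
      then have "(\<Sum>(x,K)\<in>p1. ?G K) = (\<Sum>K\<in>snd ` p1. ?G K)"
        by (simp add: case_prod_unfold o_def)
      also have "\<dots> = (\<Sum>(u,v)\<in>?D. norm (f v - f u))"
        by (simp add: sum.reindex[OF inj])
      also have "\<dots> < e"
      proof (rule d)
        show "finite ?D" using fin by simp
        have "Inf K \<le> Sup K \<and> {Inf K..Sup K} \<subseteq> {a..b}" if "K \<in> snd ` p1" for K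
          using cell1[OF that] by auto
        then show "\<forall>(u,v)\<in>?D. u \<le> v \<and> {u..v} \<subseteq> {a..b}" by blast
        show "pairwise (\<lambda>(a,b) (a',b'). {a<..<b} \<inter> {a'<..<b'} = {}) ?D"
        proof (rule pairwiseI)
          fix s t assume "s \<in> ?D" "t \<in> ?D" and ne: "s \<noteq> t"
          then obtain K L where K: "K \<in> snd ` p1" and L: "L \<in> snd ` p1"
            and st: "s = (Inf K, Sup K)" "t = (Inf L, Sup L)" by blast
          have "interior K \<inter> interior L = {}"
            by (rule division_ofD(5)[OF div K L]) (use ne st in auto)
          moreover obtain u v where "K = {u..v}" "u \<le> v" using cell1[OF K] by blast
          moreover obtain u' v' where "L = {u'..v'}" "u' \<le> v'" using cell1[OF L] by blast
          ultimately show "(\<lambda>(a,b) (a',b'). {a<..<b} \<inter> {a'<..<b'} = {}) s t"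
            by (simp add: st interior_atLeastAtMost_real)
        qed
        have "(\<Sum>(u,v)\<in>?D. v - u) = (\<Sum>K\<in>snd ` p1. Sup K - Inf K)"
          by (simp add: sum.reindex[OF inj])
        also have "\<dots> = (\<Sum>K\<in>snd ` p1. measure lebesgue K)"
        proof (rule sum.cong)
          fix K assume "K \<in> snd ` p1"
          from cell1[OF this] show "Sup K - Inf K = measure lebesgue K" by auto
        qed simp
        also have "\<dots> = measure lebesgue (\<Union>(snd ` p1))"
          by (rule content_division[OF div])
        also have "\<dots> \<le> measure lebesgue T"
        proof (rule measure_mono_fmeasurable)
          show "\<Union>(snd ` p1) \<subseteq> T"
          proof (rule Union_least)
            fix K assume "K \<in> snd ` p1"
            from cell1[OF this] show "K \<subseteq> T" by blast
          qed
          show "\<Union>(snd ` p1) \<in> sets lebesgue"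
            using lmeasurable_division[OF div] by (simp add: fmeasurableD)
        qed (rule Tm)
        also note mT
        finally show "(\<Sum>(u,v)\<in>?D. v - u) < d" .
      qed
      finally show ?thesis .
    qed
    have good: "(\<Sum>(x,K)\<in>p2. ?G K) \<le> e * (b - a)"
    proof -
      have "(\<Sum>(x,K)\<in>p2. ?G K) \<le> (\<Sum>(x,K)\<in>p2. e * (Sup K - Inf K))"
      proof (rule sum_mono, clarify)
        fix x K assume "(x, K) \<in> p2"
        then have xK: "(x, K) \<in> p" "x \<notin> N" by (auto simp: p2_def)
        from cell[OF xK(1)] obtain u v where uv: "K = {u..v}" "u \<le> x" "x \<le> v" "a \<le> u" "v \<le> b"
          "{u..v} \<subseteq> ball x (r x)" by blast
        have "u \<in> ball x (r x)" "v \<in> ball x (r x)"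
          using subsetD[OF uv(6), of u] subsetD[OF uv(6), of v] uv(2,3) by simp_all
        then have near: "\<bar>u - x\<bar> < r x" "\<bar>v - x\<bar> < r x" by (auto simp: dist_real_def)
        have "x \<in> {a..b} - N" "u \<in> {a..b}" "v \<in> {a..b}" using uv(2-5) xK(2) by auto
        then have "norm (f u - f x) \<le> e * \<bar>u - x\<bar>" "norm (f v - f x) \<le> e * \<bar>v - x\<bar>"
          using near by (auto simp del: Diff_iff intro: r(3))
        moreover have "norm (f v - f u) \<le> norm (f v - f x) + norm (f u - f x)"
          using norm_triangle_ineq4[of "f v - f x" "f u - f x"] by simp
        ultimately have "norm (f v - f u) \<le> e * (v - u)"
          using uv by (simp add: algebra_simps)
        then show "?G K \<le> e * (Sup K - Inf K)" using uv by simp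
      qed
      also have "\<dots> \<le> (\<Sum>(x,K)\<in>p. e * (Sup K - Inf K))"
      proof (rule sum_mono2)
        fix q assume "q \<in> p - p2"
        then show "0 \<le> (case q of (x, K) \<Rightarrow> e * (Sup K - Inf K))"
          using cell[of "fst q" "snd q"] \<open>e > 0\<close> by (auto simp: case_prod_unfold)
      qed (use pD(1) in \<open>auto simp: p2_def\<close>)
      also have "\<dots> = e * (b - a)"
        using additive_tagged_division_1[OF \<open>a \<le> b\<close> p, of "\<lambda>x. x"]
        by (simp add: sum_distrib_left[symmetric] case_prod_unfold)
      finally show ?thesis .
    qed
    have "norm (f b - f a) = norm (\<Sum>(x,K)\<in>p. f (Sup K) - f (Inf K))"
      using additive_tagged_division_1[OF \<open>a \<le> b\<close> p, of f] by simp
    also have "\<dots> \<le> (\<Sum>(x,K)\<in>p. ?G K)"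
      by (rule sum_norm_le) auto
    also have "\<dots> = (\<Sum>(x,K)\<in>p1. ?G K) + (\<Sum>(x,K)\<in>p2. ?G K)"
      unfolding p12(1) by (rule sum.union_disjoint[OF fin p12(2)])
    finally show ?thesis using bad good by simp
  qed
  have "norm (f b - f a) \<le> 0"
  proof (rule field_le_epsilon)
    fix e :: real assume "e > 0"
    define e' where "e' = e / (b - a + 1)"
    have "e' > 0" using \<open>e > 0\<close> \<open>a \<le> b\<close> by (simp add: e'_def)
    have "e' * (b - a) + e' = e' * (b - a + 1)" by (simp add: algebra_simps)
    also have "\<dots> = e" using \<open>a \<le> b\<close> by (simp add: e'_def)
    finally show "norm (f b - f a) \<le> 0 + e" using small[OF \<open>e' > 0\<close>] by simp
  qed
  then show ?thesis by simp
qed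

lemma locally_abs_continuous_on_zero_derivative_const:
  fixes f :: "real \<Rightarrow> 'a::real_normed_vector"
  assumes I: "is_interval I" "x \<in> I" "y \<in> I" and ac: "locally_abs_continuous_on I f"
    and deriv: "AE x\<in>I in lebesgue. (f has_vector_derivative 0) (at x within I)"
  shows "f x = f y"
proof -
  have *: "f v = f u" if "u \<in> I" "v \<in> I" "u \<le> v" for u v
  proof (rule abs_continuous_on_zero_derivative_const[OF \<open>u \<le> v\<close>])
    have sub: "{u..v} \<subseteq> I" 
    proof
      fix t assume "t \<in> {u..v}"
      then show "t \<in> I" using mem_is_interval_1_I[OF I(1) \<open>u \<in> I\<close> \<open>v \<in> I\<close>] by simp
    qed
    then show "abs_continuous_on {u..v} f" using ac by (auto simp: locally_abs_continuous_on_def)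
    show "AE x\<in>{u..v} in lebesgue. (f has_vector_derivative 0) (at x within {u..v})"
      using deriv
    proof eventually_elim
      case (elim x)
      then show ?case using sub has_vector_derivative_within_subset[OF _ sub] by blast
    qed
  qed
  show ?thesis using *[of x y] *[of y x] I(2,3) by (cases "x \<le> y") auto
qed

section \<open>Algebra of complex matrices\<close>

lemma cscale_nth: "(z *\<^sub>C M) $ a $ b = z * M $ a $ b"
  by (simp add: cscale_def map_matrix_def)

lemma ctranspose_nth: "M\<^sup>\<dagger> $ a $ b = cnj (M $ b $ a)"
  by (simp add: ctranspose_def map_matrix_def transpose_def)

lemma matrix_mult_uminus_left: "(- M) ** N = - (M ** (N :: complex^'b^'c))"
  and matrix_mult_uminus_right: "M ** (- N) = - (M ** (N :: complex^'b^'c))"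
  by (simp_all add: vec_eq_iff matrix_matrix_mult_def sum_negf)

lemma matrix_mult_diff_left: "(M - M') ** N = M ** N - M' ** (N :: complex^'b^'c)"
  and matrix_mult_diff_right: "M ** (N - N') = M ** N - M ** (N' :: complex^'b^'c)"
  by (simp_all add: vec_eq_iff matrix_matrix_mult_def sum_subtractf algebra_simps)

lemma matrix_mult_add_left: "(M + M') ** N = M ** N + M' ** (N :: complex^'b^'c)"
  by (simp add: vec_eq_iff matrix_matrix_mult_def sum.distrib algebra_simps)

lemma matrix_mult_cscale_left: "(z *\<^sub>C M) ** N = z *\<^sub>C (M ** N)"
  and matrix_mult_cscale_right: "M ** (z *\<^sub>C N) = z *\<^sub>C (M ** N)"
  by (simp_all add: vec_eq_iff matrix_matrix_mult_def cscale_nth sum_distrib_left algebra_simps)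

lemma cscale_add: "z *\<^sub>C (M + N) = z *\<^sub>C M + z *\<^sub>C N"
  and cscale_diff: "z *\<^sub>C (M - N) = z *\<^sub>C M - z *\<^sub>C N"
  and cscale_minus: "z *\<^sub>C (- M) = - (z *\<^sub>C M)"
  and cscale_cscale: "z *\<^sub>C w *\<^sub>C M = (z * w) *\<^sub>C M"
  and cscale_1: "1 *\<^sub>C M = M"
  and cscale_minus_left: "(- z) *\<^sub>C M = - (z *\<^sub>C M)"
  by (simp_all add: vec_eq_iff cscale_nth algebra_simps)

lemma cscale_sum: "z *\<^sub>C (\<Sum>k\<in>K. M k) = (\<Sum>k\<in>K. z *\<^sub>C M k)"
  by (simp add: vec_eq_iff cscale_nth sum_distrib_left)

lemma mat_mult_eq_cscale: "mat z ** M = z *\<^sub>C M" "M ** mat z = z *\<^sub>C (M :: complex^'b^'a)"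
  by (simp_all add: vec_eq_iff matrix_matrix_mult_def mat_def cscale_nth if_distrib if_distribR
      mult.commute cong: if_cong)

lemma ctranspose_ctranspose [simp]: "(M\<^sup>\<dagger>)\<^sup>\<dagger> = M"
  by (simp add: vec_eq_iff ctranspose_nth)

lemma ctranspose_add: "(M + N)\<^sup>\<dagger> = M\<^sup>\<dagger> + N\<^sup>\<dagger>"
  and ctranspose_diff: "(M - N)\<^sup>\<dagger> = M\<^sup>\<dagger> - N\<^sup>\<dagger>"
  and ctranspose_minus: "(- M)\<^sup>\<dagger> = - M\<^sup>\<dagger>"
  and ctranspose_cscale: "(z *\<^sub>C M)\<^sup>\<dagger> = cnj z *\<^sub>C M\<^sup>\<dagger>"
  by (simp_all add: vec_eq_iff ctranspose_nth cscale_nth)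

lemma ctranspose_sum: "(\<Sum>k\<in>K. M k)\<^sup>\<dagger> = (\<Sum>k\<in>K. (M k)\<^sup>\<dagger>)"
  by (simp add: vec_eq_iff ctranspose_nth)

lemma ctranspose_mult: "(M ** N)\<^sup>\<dagger> = N\<^sup>\<dagger> ** M\<^sup>\<dagger>"
  by (simp add: vec_eq_iff ctranspose_nth matrix_matrix_mult_def mult.commute)

lemma ctranspose_mat: "(mat z)\<^sup>\<dagger> = mat (cnj z)"
  by (auto simp: vec_eq_iff ctranspose_nth mat_def)

text \<open>Rewriting with these rules and with associativity brings a noncommutative polynomial in
  matrices to a sum of scalar multiples of words, which settles the identities below.\<close>
lemmas matrix_expand = matrix_mult_add_left matrix_add_ldistrib matrix_mult_diff_left
  matrix_mult_diff_right matrix_mult_uminus_left matrix_mult_uminus_right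
  matrix_mult_cscale_left matrix_mult_cscale_right cscale_add cscale_diff cscale_minus
  cscale_minus_left cscale_cscale cscale_1

lemma ctranspose_sigmat: "(sigmat m1)\<^sup>\<dagger> = sigmat m1"
  by (simp add: vec_eq_iff ctranspose_nth sigmat_def)

lemma sigmat_mult_self:
  "sigmat m1 ** sigmat m1 = (mat 1 :: complex^('m::{finite,linorder})^('m::{finite,linorder}))"
proof -
  define d :: "'m \<Rightarrow> complex" where "d a = (if card {i. i < a} < m1 then 1 else -1)" for a
  have sig: "sigmat m1 $ a $ b = (if b = a then d a else 0)" for a b :: 'm
    by (auto simp: sigmat_def d_def)
  have "(\<Sum>c\<in>UNIV. sigmat m1 $ a $ c * sigmat m1 $ c $ b)
      = (mat 1 :: complex^('m::{finite,linorder})^('m::{finite,linorder})) $ a $ b" for a b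
  proof -
    have "(\<Sum>c\<in>UNIV. sigmat m1 $ a $ c * sigmat m1 $ c $ b)
        = (\<Sum>c\<in>UNIV. if c = a then d a * sigmat m1 $ a $ b else 0)"
      by (rule sum.cong) (auto simp: sig)
    also have "\<dots> = d a * sigmat m1 $ a $ b" by simp
    also have "\<dots> = mat 1 $ a $ b" by (simp add: sig mat_def) (simp add: d_def)
    finally show ?thesis .
  qed
  then show ?thesis by (simp add: vec_eq_iff matrix_matrix_mult_def)
qed

lemma matrix_inv_mult:
  assumes "invertible (M :: complex^'n^'n)"
  shows "M ** matrix_inv M = mat 1" "matrix_inv M ** M = mat 1"
proof -
  from assms have "\<exists>N. M ** N = mat 1 \<and> N ** M = mat 1" by (simp add: invertible_def)
  then have "M ** matrix_inv M = mat 1 \<and> matrix_inv M ** M = mat 1"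
    unfolding matrix_inv_def by (rule someI_ex)
  then show "M ** matrix_inv M = mat 1" "matrix_inv M ** M = mat 1" by auto
qed

lemma matrix_inv_eqI:
  fixes M N :: "complex^'n^'n"
  assumes "M ** N = mat 1" "N ** M = mat 1"
  shows "matrix_inv M = N"
proof -
  have "invertible M" using assms by (auto simp: invertible_def)
  from matrix_inv_mult(2)[OF this] have "matrix_inv M ** (M ** N) = N"
    by (simp add: matrix_mul_assoc)
  then show ?thesis using assms by simp
qed

lemma ctranspose_matrix_inv:
  assumes "invertible (M :: complex^'n^'n)"
  shows "matrix_inv (M\<^sup>\<dagger>) = (matrix_inv M)\<^sup>\<dagger>"
  by (rule matrix_inv_eqI)
    (simp_all add: ctranspose_mult[symmetric] matrix_inv_mult[OF assms] ctranspose_mat)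

section \<open>Inverses of matrix functions\<close>

lemma bounded_bilinear_matrix_mult:
  "bounded_bilinear (\<lambda>(M :: complex^'b^'a) (N :: complex^'c^'b). M ** N)"
  unfolding bilinear_conv_bounded_bilinear[symmetric] bilinear_def
  by (auto intro!: linearI simp: matrix_add_ldistrib matrix_mult_add_left
      matrix_scalar_ac scalar_matrix_assoc)

lemmas matrix_mult_sum_left = bounded_bilinear.sum_left[OF bounded_bilinear_matrix_mult]
  and matrix_mult_sum_right = bounded_bilinear.sum_right[OF bounded_bilinear_matrix_mult]

lemmas matrix_mult_scaleR_left = bounded_bilinear.scaleR_left[OF bounded_bilinear_matrix_mult]
  and matrix_mult_scaleR_right = bounded_bilinear.scaleR_right[OF bounded_bilinear_matrix_mult]

lemma bounded_linear_cscale: "bounded_linear (\<lambda>M :: complex^'b^'a. z *\<^sub>C M)"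
  unfolding linear_conv_bounded_linear[symmetric]
  by (rule linearI) (simp_all add: vec_eq_iff cscale_nth algebra_simps)

lemma bounded_linear_ctranspose: "bounded_linear (\<lambda>M :: complex^'b^'a. M\<^sup>\<dagger>)"
  unfolding linear_conv_bounded_linear[symmetric]
  by (rule linearI) (simp_all add: vec_eq_iff ctranspose_nth)

lemma matrix_mult_norm_bound:
  obtains C where "C > 0"
    "\<And>(M :: complex^'b^'a) (N :: complex^'c^'b). norm (M ** N) \<le> C * norm M * norm N"
proof -
  interpret bounded_bilinear "\<lambda>(M :: complex^'b^'a) (N :: complex^'c^'b). M ** N"
    by (rule bounded_bilinear_matrix_mult)
  obtain K where "K > 0" "\<And>(M :: complex^'b^'a) (N :: complex^'c^'b). norm (M ** N) \<le> norm M * norm N * K"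
    using pos_bounded by blast
  then show ?thesis using that[of K] by (simp add: mult.commute mult.left_commute)
qed

lemma matrix_inv_diff:
  assumes "invertible M" "invertible (N :: complex^'n^'n)"
  shows "matrix_inv N - matrix_inv M = - (matrix_inv N ** (N - M) ** matrix_inv M)"
  by (simp add: matrix_expand matrix_inv_mult[OF assms(1)] matrix_inv_mult[OF assms(2)]
      matrix_mul_assoc[of _ M, symmetric])

text \<open>Near \<open>M\<close> the determinant stays nonzero. From
  \<open>N\<^sup>-\<^sup>1 - M\<^sup>-\<^sup>1 = - N\<^sup>-\<^sup>1 (N - M) M\<^sup>-\<^sup>1\<close> one first bounds \<open>N\<^sup>-\<^sup>1\<close> for \<open>N\<close> close to \<open>M\<close>, by absorbing
  half of its norm into the left-hand side, and then reads off a Lipschitz estimate.\<close>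
lemma continuous_matrix_inv:
  fixes M :: "complex^'n^'n"
  assumes inv: "invertible M"
  shows "eventually invertible (nhds M)" and "isCont matrix_inv M"
proof -
  obtain C where "C > 0" and
    C: "\<And>(M :: complex^'n^'n) (N :: complex^'n^'n). norm (M ** N) \<le> C * norm M * norm N"
    using matrix_mult_norm_bound[where ?'a = 'n and ?'b = 'n and ?'c = 'n] by blast
  define K where "K = norm (matrix_inv M) + 1"
  have "K > 0" and K: "norm (matrix_inv M) \<le> K" by (auto simp: K_def add_nonneg_pos)
  \<comment> \<open>This radius makes the error term at most half of the norm of \<open>N\<^sup>-\<^sup>1\<close> in the estimate \<open>bound\<close>.\<close>
  define e where "e = 1 / (2 * C * C * K)"
  have "e > 0" using \<open>C > 0\<close> \<open>K > 0\<close> by (auto simp: e_def)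
  show ev: "eventually invertible (nhds M)"
  proof -
    have "continuous_on UNIV (\<lambda>N :: complex^'n^'n. det N)"
      unfolding det_def by (intro continuous_intros)
    then have "open {N :: complex^'n^'n. det N \<noteq> 0}"
      by (intro open_Collect_neq continuous_on_const)
    then show ?thesis
      using inv by (auto simp: eventually_nhds invertible_det_nz intro!: exI[of _ "{N. det N \<noteq> 0}"])
  qed
  have bound: "norm (matrix_inv N) \<le> 2 * K" if N: "invertible N" "norm (N - M) < e" for N
  proof -
    have "norm (matrix_inv N ** (N - M) ** matrix_inv M)
        \<le> C * (C * norm (matrix_inv N) * norm (N - M)) * norm (matrix_inv M)"
      using C \<open>C > 0\<close> by (intro order_trans[OF C] mult_right_mono mult_left_mono) auto
    also have "\<dots> \<le> C * (C * norm (matrix_inv N) * e) * K"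
      using \<open>C > 0\<close> \<open>e > 0\<close> \<open>K > 0\<close> N(2) K by (intro mult_mono mult_nonneg_nonneg order_refl) auto
    also have "\<dots> = norm (matrix_inv N) / 2"
      using \<open>C > 0\<close> \<open>K > 0\<close> by (simp add: e_def field_simps)
    finally have "norm (matrix_inv N - matrix_inv M) \<le> norm (matrix_inv N) / 2"
      by (simp add: matrix_inv_diff[OF inv N(1)])
    then have "norm (matrix_inv N) \<le> norm (matrix_inv N) / 2 + norm (matrix_inv M)"
      using norm_triangle_sub[of "matrix_inv N" "matrix_inv M"] by linarith
    then show ?thesis using K by linarith
  qed
  have "eventually (\<lambda>N. norm (matrix_inv N - matrix_inv M) \<le> C * C * 2 * K * K * norm (N - M)) (at M)"
  proof -
    have "eventually (\<lambda>N. norm (N - M) < e) (nhds M)"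
      using \<open>e > 0\<close> unfolding eventually_nhds_metric dist_norm by blast
    with ev have "eventually (\<lambda>N. norm (matrix_inv N - matrix_inv M) \<le> C * C * 2 * K * K * norm (N - M)) (nhds M)"
    proof eventually_elim
      case (elim N)
      have "norm (matrix_inv N ** (N - M) ** matrix_inv M)
          \<le> C * (C * norm (matrix_inv N) * norm (N - M)) * norm (matrix_inv M)"
        using C \<open>C > 0\<close> by (intro order_trans[OF C] mult_right_mono mult_left_mono) auto
      also have "\<dots> \<le> C * (C * (2 * K) * norm (N - M)) * K"
        using \<open>C > 0\<close> \<open>K > 0\<close> bound[OF elim] K by (intro mult_mono mult_nonneg_nonneg order_refl) auto
      finally show ?case by (simp add: matrix_inv_diff[OF inv elim(1)] algebra_simps)
    qed
    then show ?thesis by (simp add: eventually_at_filter eventually_mono)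
  qed
  moreover have "((\<lambda>N. C * C * 2 * K * K * norm (N - M)) \<longlongrightarrow> C * C * 2 * K * K * norm (M - M)) (at M)"
    by (intro tendsto_intros)
  then have "((\<lambda>N. C * C * 2 * K * K * norm (N - M)) \<longlongrightarrow> 0) (at M)" by simp
  ultimately have "((\<lambda>N. matrix_inv N - matrix_inv M) \<longlongrightarrow> 0) (at M)"
    by (rule Lim_null_comparison)
  then show "isCont matrix_inv M"
    unfolding isCont_def using LIM_zero_iff by blast
qed

text \<open>For curves the derivative is the limit of difference quotients. In this form the derivative of
  the inverse follows from the exact formula for a difference of two inverses.\<close>
lemma has_vector_derivative_iff_quotient:
  fixes f :: "real \<Rightarrow> 'a::real_normed_vector"
  shows "(f has_vector_derivative f') (at x within X) \<longleftrightarrow>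
    ((\<lambda>y. (1 / (y - x)) *\<^sub>R (f y - f x)) \<longlongrightarrow> f') (at x within X)"
proof -
  have eq: "norm (f y - f x - (y - x) *\<^sub>R f') / norm (y - x)
      = norm ((1 / (y - x)) *\<^sub>R (f y - f x) - f')" if "y \<noteq> x" for y
  proof -
    have "(1 / (y - x)) *\<^sub>R (f y - f x - (y - x) *\<^sub>R f') = (1 / (y - x)) *\<^sub>R (f y - f x) - f'"
      using that by (simp add: scaleR_diff_right)
    then have "norm ((1 / (y - x)) *\<^sub>R (f y - f x) - f')
        = \<bar>1 / (y - x)\<bar> * norm (f y - f x - (y - x) *\<^sub>R f')"
      by (metis norm_scaleR)
    then show ?thesis by (simp add: abs_divide)
  qed
  have "(f has_vector_derivative f') (at x within X) \<longleftrightarrow>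
      ((\<lambda>y. norm (f y - f x - (y - x) *\<^sub>R f') / norm (y - x)) \<longlongrightarrow> 0) (at x within X)"
    by (simp add: has_vector_derivative_def has_derivative_iff_norm bounded_linear_scaleR_left)
  also have "\<dots> \<longleftrightarrow> ((\<lambda>y. norm ((1 / (y - x)) *\<^sub>R (f y - f x) - f')) \<longlongrightarrow> 0) (at x within X)"
    by (rule Lim_cong_within) (use eq in auto)
  also have "\<dots> \<longleftrightarrow> ((\<lambda>y. (1 / (y - x)) *\<^sub>R (f y - f x)) \<longlongrightarrow> f') (at x within X)"
    by (simp add: tendsto_norm_zero_iff LIM_zero_iff)
  finally show ?thesis .
qed

lemma has_vector_derivative_matrix_inv:
  fixes F :: "real \<Rightarrow> complex^'n^'n"
  assumes F: "(F has_vector_derivative F') (at x within X)" and inv: "invertible (F x)"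
  shows "((\<lambda>y. matrix_inv (F y)) has_vector_derivative
            - (matrix_inv (F x) ** F' ** matrix_inv (F x))) (at x within X)"
proof -
  interpret bounded_bilinear "\<lambda>(M :: complex^'n^'n) (N :: complex^'n^'n). M ** N"
    by (rule bounded_bilinear_matrix_mult)
  let ?q = "\<lambda>G y. (1 / (y - x)) *\<^sub>R (G y - G x)"
  have cont: "(F \<longlongrightarrow> F x) (at x within X)"
    using has_vector_derivative_continuous[OF F] by (simp add: continuous_within)
  have "eventually (\<lambda>y. invertible (F y)) (at x within X)"
    using continuous_matrix_inv(1)[OF inv] cont by (rule eventually_compose_filterlim)
  then have "eventually (\<lambda>y. - (matrix_inv (F y) ** ?q F y ** matrix_inv (F x))
      = ?q (\<lambda>y. matrix_inv (F y)) y) (at x within X)"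
  proof eventually_elim
    case (elim y)
    show ?case
      by (simp add: matrix_inv_diff[OF inv elim] scaleR_left scaleR_right)
  qed
  moreover have "((\<lambda>y. - (matrix_inv (F y) ** ?q F y ** matrix_inv (F x))) \<longlongrightarrow>
      - (matrix_inv (F x) ** F' ** matrix_inv (F x))) (at x within X)"
  proof (intro tendsto_minus tendsto tendsto_const)
    show "((\<lambda>y. matrix_inv (F y)) \<longlongrightarrow> matrix_inv (F x)) (at x within X)"
      by (rule isCont_tendsto_compose[OF continuous_matrix_inv(2)[OF inv] cont])
    show "(?q F \<longlongrightarrow> F') (at x within X)"
      using F by (simp add: has_vector_derivative_iff_quotient)
  qed
  ultimately have "(?q (\<lambda>y. matrix_inv (F y)) \<longlongrightarrow> - (matrix_inv (F x) ** F' ** matrix_inv (F x))) (at x within X)"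
    by (rule Lim_transform_eventually[rotated])
  then show ?thesis by (simp add: has_vector_derivative_iff_quotient)
qed

text \<open>On a compact interval the inverse is bounded, being continuous, so the formula for a difference
  of two inverses bounds an increment of the inverse by a multiple of the increment of \<open>F\<close>.\<close>
lemma abs_continuous_on_matrix_inv:
  fixes F :: "real \<Rightarrow> complex^'n^'n"
  assumes F: "abs_continuous_on {a..b} F" and inv: "\<And>x. x \<in> {a..b} \<Longrightarrow> invertible (F x)"
  shows "abs_continuous_on {a..b} (\<lambda>x. matrix_inv (F x))"
proof -
  obtain C where "C > 0" and
    C: "\<And>(M :: complex^'n^'n) (N :: complex^'n^'n). norm (M ** N) \<le> C * norm M * norm N"
    using matrix_mult_norm_bound[where ?'a = 'n and ?'b = 'n and ?'c = 'n] by blast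
  have "continuous_on {a..b} F" by (rule abs_continuous_on_imp_continuous_on[OF F])
  then have "continuous_on {a..b} (\<lambda>x. matrix_inv (F x))"
    unfolding continuous_on_def
    by (auto intro: isCont_tendsto_compose[OF continuous_matrix_inv(2)[OF inv]])
  then have "bounded ((\<lambda>x. matrix_inv (F x)) ` {a..b})"
    by (intro compact_imp_bounded compact_continuous_image) auto
  then obtain L where "L > 0" and L: "\<And>x. x \<in> {a..b} \<Longrightarrow> norm (matrix_inv (F x)) \<le> L"
    unfolding bounded_pos by (metis image_eqI)
  show ?thesis
  proof (rule abs_continuous_on_dominated[OF F F])
    fix x y assume x: "x \<in> {a..b}" and y: "y \<in> {a..b}"
    have "norm (matrix_inv (F y) - matrix_inv (F x))
        = norm (matrix_inv (F y) ** (F y - F x) ** matrix_inv (F x))"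
      by (simp add: matrix_inv_diff[OF inv[OF x] inv[OF y]])
    also have "\<dots> \<le> C * (C * norm (matrix_inv (F y)) * norm (F y - F x)) * norm (matrix_inv (F x))"
      using C \<open>C > 0\<close> by (intro order_trans[OF C] mult_right_mono mult_left_mono) auto
    also have "\<dots> \<le> C * (C * L * norm (F y - F x)) * L"
      using L[OF x] L[OF y] \<open>C > 0\<close> \<open>L > 0\<close>
      by (intro mult_mono mult_nonneg_nonneg order_refl) auto
    finally show "norm (matrix_inv (F y) - matrix_inv (F x))
        \<le> (C * C * L * L / 2) * (norm (F y - F x) + norm (F y - F x))"
      by (simp add: algebra_simps)
  qed
qed

section \<open>The matrix exponential\<close>

text \<open>The norm at hand is submultiplicative only up to a constant \<open>C\<close>, which turns the usual geometric
  bound into one with ratio \<open>C b\<close>. The factorials in the exponential series absorb it.\<close>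
lemma matpow_norm_bound:
  fixes M :: "complex^'n^'n"
  assumes C: "\<And>(M :: complex^'n^'n) (N :: complex^'n^'n). norm (M ** N) \<le> C * norm M * norm N"
    and "C > 0" and "norm M \<le> b"
  shows "norm (matpow M k) \<le> norm (mat 1 :: complex^'n^'n) * (C * b) ^ k"
proof (induction k)
  case (Suc k)
  have "norm (matpow M (Suc k)) \<le> C * norm M * norm (matpow M k)" using C by simp
  also have "\<dots> \<le> C * b * (norm (mat 1 :: complex^'n^'n) * (C * b) ^ k)"
    using assms(2,3) order_trans[OF norm_ge_zero assms(3)] Suc by (intro mult_mono) auto
  finally show ?case by (simp add: algebra_simps)
qed simp

lemma matexp_sums: "(\<lambda>k. (1 / fact k) *\<^sub>R matpow M k) sums matexp (M :: complex^'n^'n)"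
proof -
  obtain C where "C > 0" and
    C: "\<And>(M :: complex^'n^'n) (N :: complex^'n^'n). norm (M ** N) \<le> C * norm M * norm N"
    using matrix_mult_norm_bound[where ?'a = 'n and ?'b = 'n and ?'c = 'n] by blast
  let ?K = "norm (mat 1 :: complex^'n^'n)"
  have "summable (\<lambda>k. ?K * (inverse (fact k) * (C * norm M) ^ k))"
    by (intro summable_mult summable_exp)
  then have "summable (\<lambda>k. (1 / fact k) *\<^sub>R matpow M k)"
  proof (rule summable_comparison_test[rotated], intro exI allI impI)
    fix k
    show "norm ((1 / fact k) *\<^sub>R matpow M k) \<le> ?K * (inverse (fact k) * (C * norm M) ^ k)"
      using mult_left_mono[OF matpow_norm_bound[OF C \<open>C > 0\<close> order_refl, of M k], of "1 / fact k"]
      by (simp add: field_simps)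
  qed
  then show ?thesis unfolding matexp_def by (rule summable_sums)
qed

lemma has_vector_derivative_matpow:
  fixes M R :: "complex^'n^'n"
  assumes comm: "M ** R = R ** M"
  shows "((\<lambda>t. matpow (M + t *\<^sub>R R) k) has_vector_derivative
            real k *\<^sub>R (R ** matpow (M + t *\<^sub>R R) (k - 1))) (at t)"
proof (induction k)
  case 0
  show ?case by simp
next
  case (Suc k)
  let ?X = "M + t *\<^sub>R R"
  have XR: "?X ** R = R ** ?X"
    using comm by (simp add: matrix_mult_add_left matrix_add_ldistrib matrix_mult_scaleR_left
        matrix_mult_scaleR_right)
  have "((\<lambda>t. M + t *\<^sub>R R) has_vector_derivative R) (at t)"
    by (auto intro!: derivative_eq_intros)
  note bounded_bilinear.has_vector_derivative[OF bounded_bilinear_matrix_mult this Suc.IH]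
  moreover have "?X ** (real k *\<^sub>R (R ** matpow ?X (k - 1))) + R ** matpow ?X k
      = real (Suc k) *\<^sub>R (R ** matpow ?X k)"
  proof (cases k)
    case (Suc l)
    have "?X ** (R ** matpow ?X l) = R ** matpow ?X (Suc l)"
      by (simp only: matpow.simps matrix_mul_assoc XR)
    then show ?thesis
      unfolding Suc diff_Suc_1 matrix_mult_scaleR_right
      by (simp only: of_nat_Suc scaleR_add_left scaleR_one ac_simps)
  qed (simp add: matrix_mult_scaleR_right)
  ultimately show ?case by simp
qed

text \<open>Because \<open>M\<close> and \<open>R\<close> commute, the \<open>n\<close>-th term of the exponential series along the line
  \<open>M + t R\<close> has derivative \<open>R (M + t R)\<^sup>n\<^sup>-\<^sup>1 / (n - 1)!\<close>. Near a fixed \<open>t\<close> these derivatives are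
  dominated by a convergent series of numbers, so the series may be differentiated term by term.\<close>
lemma has_vector_derivative_matexp:
  fixes M R :: "complex^'n^'n"
  assumes comm: "M ** R = R ** M"
  shows "((\<lambda>t. matexp (M + t *\<^sub>R R)) has_vector_derivative R ** matexp (M + t *\<^sub>R R)) (at t)"
proof -
  obtain C where "C > 0" and
    C: "\<And>(M :: complex^'n^'n) (N :: complex^'n^'n). norm (M ** N) \<le> C * norm M * norm N"
    using matrix_mult_norm_bound[where ?'a = 'n and ?'b = 'n and ?'c = 'n] by blast
  let ?K = "norm (mat 1 :: complex^'n^'n)"
  define X where "X s = M + s *\<^sub>R R" for s :: real
  define g where "g n s = (1 / fact n) *\<^sub>R (real n *\<^sub>R (R ** matpow (X s) (n - 1)))" for n s
  define b where "b = norm M + (\<bar>t\<bar> + 1) * norm R"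
  define B where "B n = (case n of 0 \<Rightarrow> 0 | Suc n \<Rightarrow> (C * norm R * ?K) * (inverse (fact n) * (C * b) ^ n))"
    for n :: nat
  have g_Suc: "g (Suc n) s = R ** ((1 / fact n) *\<^sub>R matpow (X s) n)" for n s
    unfolding g_def by (simp add: matrix_mult_scaleR_right field_simps del: of_nat_Suc)
  have "g 0 s = 0" for s by (simp add: g_def)
  have Xb: "norm (X s) \<le> b" if "s \<in> ball t 1" for s
  proof -
    have "\<bar>s\<bar> \<le> \<bar>t\<bar> + 1" using that by (auto simp: dist_real_def)
    then have "norm (s *\<^sub>R R) \<le> (\<bar>t\<bar> + 1) * norm R" by (simp add: mult_right_mono)
    then show ?thesis unfolding X_def b_def by (rule norm_triangle_le[OF add_left_mono])
  qed
  have g_le: "norm (g n s) \<le> B n" if "s \<in> ball t 1" for n s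
  proof (cases n)
    case (Suc l)
    have "norm (g n s) \<le> C * norm R * norm ((1 / fact l) *\<^sub>R matpow (X s) l)"
      unfolding Suc g_Suc by (rule C)
    also have "\<dots> \<le> C * norm R * (inverse (fact l) * (?K * (C * b) ^ l))"
      using matpow_norm_bound[OF C \<open>C > 0\<close> Xb[OF that], of l] \<open>C > 0\<close>
      by (intro mult_left_mono) (auto simp: field_simps)
    finally show ?thesis by (simp add: B_def Suc algebra_simps)
  qed (simp add: B_def \<open>g 0 s = 0\<close>)
  have "summable (\<lambda>n. B (Suc n))"
    unfolding B_def by (simp only: nat.case) (intro summable_mult summable_exp)
  then have "summable B" by (simp only: summable_Suc_iff)
  then have "uniform_limit (ball t 1) (\<lambda>n s. \<Sum>i<n. g i s) (\<lambda>s. suminf (\<lambda>i. g i s)) sequentially"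
    by (intro Weierstrass_m_test) (use g_le in auto)
  moreover have sums: "(\<lambda>i. g i s) sums (R ** matexp (X s))" for s
  proof -
    have "bounded_linear (\<lambda>N :: complex^'n^'n. R ** N)"
      by (rule bounded_bilinear.bounded_linear_right[OF bounded_bilinear_matrix_mult])
    from bounded_linear.sums[OF this matexp_sums] have "(\<lambda>n. g (Suc n) s) sums (R ** matexp (X s))"
      by (simp add: g_Suc)
    from sums_Suc[OF this] show ?thesis by (simp add: \<open>g 0 s = 0\<close>)
  qed
  ultimately have ulim: "uniform_limit (ball t 1) (\<lambda>n s. \<Sum>i<n. g i s) (\<lambda>s. R ** matexp (X s)) sequentially"
    by (simp add: sums_iff)
  have "\<exists>G. \<forall>s\<in>ball t 1. (\<lambda>n. (1 / fact n) *\<^sub>R matpow (X s) n) sums G s \<and>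
      (G has_derivative (\<lambda>h. h *\<^sub>R (R ** matexp (X s)))) (at s within ball t 1)"
  proof (rule has_derivative_series[where f' = "\<lambda>n s h. h *\<^sub>R g n s"])
    show "((\<lambda>s. (1 / fact n) *\<^sub>R matpow (X s) n) has_derivative (\<lambda>h. h *\<^sub>R g n s)) (at s within ball t 1)"
      for n s
      using bounded_linear.has_vector_derivative[OF bounded_linear_scaleR_right
          has_vector_derivative_at_within[OF has_vector_derivative_matpow[OF comm]]]
      unfolding has_vector_derivative_def X_def g_def by blast
    show "\<forall>\<^sub>F n in sequentially. \<forall>s\<in>ball t 1. \<forall>h.
        norm ((\<Sum>i<n. h *\<^sub>R g i s) - h *\<^sub>R (R ** matexp (X s))) \<le> e * norm h" if "e > 0" for e
      using uniform_limitD[OF ulim that]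
    proof eventually_elim
      case (elim n)
      show ?case
      proof (intro ballI allI)
        fix s h assume "s \<in> ball t 1"
        then have "norm ((\<Sum>i<n. g i s) - R ** matexp (X s)) \<le> e"
          using elim by (auto simp: dist_norm intro: less_imp_le)
        then have "\<bar>h\<bar> * norm ((\<Sum>i<n. g i s) - R ** matexp (X s)) \<le> \<bar>h\<bar> * e"
          by (rule mult_left_mono) simp
        then show "norm ((\<Sum>i<n. h *\<^sub>R g i s) - h *\<^sub>R (R ** matexp (X s))) \<le> e * norm h"
          by (simp add: scaleR_sum_right[symmetric] scaleR_diff_right[symmetric] mult.commute)
      qed
    qed
    show "(\<lambda>n. (1 / fact n) *\<^sub>R matpow (X t) n) sums matexp (X t)" by (rule matexp_sums)
  qed auto
  then obtain G where G: "\<And>s. s \<in> ball t 1 \<Longrightarrow> (\<lambda>n. (1 / fact n) *\<^sub>R matpow (X s) n) sums G s"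
    and G': "(G has_derivative (\<lambda>h. h *\<^sub>R (R ** matexp (X t)))) (at t within ball t 1)" by force
  have "matexp (X s) = G s" if "s \<in> ball t 1" for s
    using sums_unique2[OF matexp_sums G[OF that]] .
  then have "((\<lambda>s. matexp (X s)) has_derivative (\<lambda>h. h *\<^sub>R (R ** matexp (X t)))) (at t)"
    using has_derivative_transform_within_open[of G _ t UNIV "ball t 1"] G'
    by (simp add: at_within_open[of t "ball t 1"])
  then show ?thesis by (simp add: has_vector_derivative_def X_def)
qed

section \<open>Resolvents and the transfer function\<close>

lemma resolvent_mult:
  fixes A :: "complex^'n^'n"
  assumes "invertible (A - mat z)"
  shows "A ** matrix_inv (A - mat z) = mat 1 + z *\<^sub>C matrix_inv (A - mat z)"
    and "matrix_inv (A - mat z) ** A = mat 1 + z *\<^sub>C matrix_inv (A - mat z)"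
proof -
  let ?R = "matrix_inv (A - mat z)"
  have "A ** ?R - z *\<^sub>C ?R = mat 1" "?R ** A - z *\<^sub>C ?R = mat 1"
    using matrix_inv_mult[OF assms] by (simp_all add: matrix_expand mat_mult_eq_cscale)
  then show "A ** ?R = mat 1 + z *\<^sub>C ?R" "?R ** A = mat 1 + z *\<^sub>C ?R"
    by (simp_all add: diff_eq_eq)
qed

lemma matrix_inv_commute:
  fixes M N :: "complex^'n^'n"
  assumes "invertible M" "M ** N = N ** M"
  shows "matrix_inv M ** N = N ** matrix_inv M"
proof -
  have "matrix_inv M ** N = matrix_inv M ** (N ** M) ** matrix_inv M"
    by (simp add: matrix_mul_assoc[symmetric] matrix_inv_mult[OF assms(1)])
  also have "\<dots> = (matrix_inv M ** M) ** N ** matrix_inv M"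
    by (simp add: assms(2)[symmetric] matrix_mul_assoc)
  finally show ?thesis by (simp add: matrix_inv_mult[OF assms(1)])
qed

lemma resolvents_commute:
  fixes A :: "complex^'n^'n"
  assumes "invertible (A - mat z)" "invertible (A - mat w)"
  shows "matrix_inv (A - mat z) ** matrix_inv (A - mat w)
       = matrix_inv (A - mat w) ** matrix_inv (A - mat z)"
proof (rule matrix_inv_commute[OF assms(1)])
  show "(A - mat z) ** matrix_inv (A - mat w) = matrix_inv (A - mat w) ** (A - mat z)"
    by (simp add: matrix_expand mat_mult_eq_cscale resolvent_mult[OF assms(2)])
qed

lemma resolvent_ctranspose:
  fixes A :: "complex^'n^'n" and c :: real
  assumes "invertible (A - mat (complex_of_real c))"
  shows "matrix_inv (A\<^sup>\<dagger> - mat (complex_of_real c)) = (matrix_inv (A - mat (complex_of_real c)))\<^sup>\<dagger>"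
  using ctranspose_matrix_inv[OF assms] by (simp add: ctranspose_diff ctranspose_mat)

lemma resolvent_ctranspose_mult:
  fixes A :: "complex^'n^'n" and c :: real
  assumes "invertible (A - mat (complex_of_real c))"
  shows "(matrix_inv (A - mat (complex_of_real c)))\<^sup>\<dagger> ** A\<^sup>\<dagger>
       = mat 1 + complex_of_real c *\<^sub>C (matrix_inv (A - mat (complex_of_real c)))\<^sup>\<dagger>"
  using resolvent_mult(1)[OF assms, THEN arg_cong[of _ _ ctranspose]]
  by (simp add: ctranspose_mult ctranspose_add ctranspose_mat ctranspose_cscale)

text \<open>This is where the operator identity enters. Multiplied by \<open>S\<^sup>-\<^sup>1\<close> from both sides it says that
  \<open>\<i> S\<^sup>-\<^sup>1 P j P\<^sup>\<dagger> S\<^sup>-\<^sup>1 = S\<^sup>-\<^sup>1 A - A\<^sup>\<dagger> S\<^sup>-\<^sup>1\<close>. Between the two resolvents, \<open>A R = 1 + c R\<close> and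
  \<open>R\<^sup>\<dagger> A\<^sup>\<dagger> = 1 + c R\<^sup>\<dagger>\<close> (here \<open>c\<close> is real) reduce the right-hand side to
  \<open>R\<^sup>\<dagger> S\<^sup>-\<^sup>1 - S\<^sup>-\<^sup>1 R\<close>, and the second term cancels against the identity summand of the
  transfer function.\<close>
lemma transfer_mat_intertwines:
  fixes A S :: "complex^'n^'n" and P :: "complex^'m^'n" and c :: real
  assumes inv: "invertible S" and res: "invertible (A - mat (complex_of_real c))"
    and j: "j\<^sup>\<dagger> = j" and S: "S\<^sup>\<dagger> = S"
    and id: "A ** S - S ** A\<^sup>\<dagger> = \<i> *\<^sub>C (P ** j ** P\<^sup>\<dagger>)"
  defines "R \<equiv> matrix_inv (A - mat (complex_of_real c))"
  shows "(transfer_mat j A S P (complex_of_real c))\<^sup>\<dagger> ** P\<^sup>\<dagger> ** matrix_inv S ** R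
       = P\<^sup>\<dagger> ** R\<^sup>\<dagger> ** matrix_inv S"
proof -
  define X where "X = matrix_inv S"
  have X: "S ** X = mat 1" "X ** S = mat 1" "X\<^sup>\<dagger> = X"
    using matrix_inv_mult[OF inv] ctranspose_matrix_inv[OF inv] by (simp_all add: X_def S)
  have XAX: "X ** (\<i> *\<^sub>C (P ** j ** P\<^sup>\<dagger>)) ** X = X ** A - A\<^sup>\<dagger> ** X"
  proof -
    have "X ** (A ** S - S ** A\<^sup>\<dagger>) ** X = X ** A ** (S ** X) - (X ** S) ** A\<^sup>\<dagger> ** X"
      by (simp only: matrix_expand matrix_mul_assoc)
    then show ?thesis by (simp add: id X)
  qed
  have "(transfer_mat j A S P (complex_of_real c))\<^sup>\<dagger> = mat 1 + \<i> *\<^sub>C (P\<^sup>\<dagger> ** R\<^sup>\<dagger> ** X ** P ** j)"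
    unfolding transfer_mat_def R_def[symmetric] X_def[symmetric]
    by (simp add: ctranspose_diff ctranspose_mat ctranspose_cscale ctranspose_mult j X
        matrix_mul_assoc cscale_minus_left)
  then have "(transfer_mat j A S P (complex_of_real c))\<^sup>\<dagger> ** P\<^sup>\<dagger> ** X ** R
      = P\<^sup>\<dagger> ** X ** R + P\<^sup>\<dagger> ** R\<^sup>\<dagger> ** (X ** (\<i> *\<^sub>C (P ** j ** P\<^sup>\<dagger>)) ** X) ** R"
    by (simp add: matrix_expand matrix_mul_assoc)
  also have "P\<^sup>\<dagger> ** R\<^sup>\<dagger> ** (X ** (\<i> *\<^sub>C (P ** j ** P\<^sup>\<dagger>)) ** X) ** R
      = P\<^sup>\<dagger> ** R\<^sup>\<dagger> ** X ** (A ** R) - P\<^sup>\<dagger> ** (R\<^sup>\<dagger> ** A\<^sup>\<dagger>) ** X ** R"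
    unfolding XAX by (simp only: matrix_expand matrix_mul_assoc)
  also have "\<dots> = P\<^sup>\<dagger> ** R\<^sup>\<dagger> ** X - P\<^sup>\<dagger> ** X ** R"
    using resolvent_mult(1)[OF res] resolvent_ctranspose_mult[OF res]
    by (simp add: R_def[symmetric] matrix_expand matrix_mul_assoc)
  finally show ?thesis by (simp add: X_def)
qed

lemma beta_tilde_gram:
  fixes A S :: "complex^'n^'n" and P :: "complex^'m^'n" and B :: "complex^'m^'p" and j :: "complex^'m^'m" and c :: real
  assumes j: "j\<^sup>\<dagger> = j"
  defines "w \<equiv> transfer_mat j A S P (complex_of_real c)"
  shows "(beta_tilde j A S P c B)\<^sup>\<dagger> ** beta_tilde j A S P c B
       = j ** w ** j ** (B\<^sup>\<dagger> ** B) ** j ** w\<^sup>\<dagger> ** j"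
  by (simp add: beta_tilde_def w_def ctranspose_mult j matrix_mul_assoc)

text \<open>The left-hand side is the contribution of one point \<open>c\<close> that the theorem predicts for the derivative of
  \<open>P\<^sup>\<dagger> S\<^sup>-\<^sup>1\<close>; the right-hand side is the one that the product rule produces. In the
  product \<open>Ht j P\<^sup>\<dagger> S\<^sup>-\<^sup>1 R\<close> the right factor \<open>w\<^sup>\<dagger>\<close> of \<open>Ht\<close> is removed by the intertwining
  relation above, and the left factor \<open>j w j\<close> is \<open>1 - \<i> P\<^sup>\<dagger> S\<^sup>-\<^sup>1 R P j\<close> by definition.\<close>
lemma dressed_weight_identity:
  fixes A S :: "complex^'n^'n" and P :: "complex^'m^'n" and c :: real and B :: "complex^'m^'p"
    and R :: "complex^'n^'n"
  assumes inv: "invertible S" and res: "invertible (A - mat (complex_of_real c))"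
    and j: "j\<^sup>\<dagger> = j" "j ** j = mat 1" and S: "S\<^sup>\<dagger> = S"
    and id: "A ** S - S ** A\<^sup>\<dagger> = \<i> *\<^sub>C (P ** j ** P\<^sup>\<dagger>)"
  defines "R \<equiv> matrix_inv (A - mat (complex_of_real c))"
    and "Ht \<equiv> (beta_tilde j A S P c B)\<^sup>\<dagger> ** beta_tilde j A S P c B"
    and "T \<equiv> B\<^sup>\<dagger> ** B ** j ** P\<^sup>\<dagger> ** R\<^sup>\<dagger>"
  shows "\<i> *\<^sub>C (Ht ** j ** P\<^sup>\<dagger> ** matrix_inv S ** R)
    = \<i> *\<^sub>C T ** matrix_inv S + P\<^sup>\<dagger> ** matrix_inv S ** R ** P ** j ** T ** matrix_inv S"
proof -
  define w where "w = transfer_mat j A S P (complex_of_real c)"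
  define X where "X = matrix_inv S"
  have jj: "M ** j ** j = M" for M :: "complex^'m^'q" 
    by (simp add: matrix_mul_assoc[symmetric] j)
  have jwj: "j ** w ** j = mat 1 - \<i> *\<^sub>C (P\<^sup>\<dagger> ** X ** R ** P ** j)"
    unfolding w_def transfer_mat_def R_def[symmetric] X_def[symmetric]
    by (simp add: matrix_expand matrix_mul_assoc j)
  have "Ht ** j ** P\<^sup>\<dagger> ** X ** R
      = j ** w ** j ** (B\<^sup>\<dagger> ** B) ** j ** w\<^sup>\<dagger> ** j ** j ** P\<^sup>\<dagger> ** X ** R"
    unfolding Ht_def w_def by (simp add: beta_tilde_gram[OF j(1)])
  also have "\<dots> = j ** w ** j ** (B\<^sup>\<dagger> ** B) ** j ** (w\<^sup>\<dagger> ** P\<^sup>\<dagger> ** X ** R)"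
    by (simp add: jj matrix_mul_assoc)
  also have "w\<^sup>\<dagger> ** P\<^sup>\<dagger> ** X ** R = P\<^sup>\<dagger> ** R\<^sup>\<dagger> ** X"
    unfolding w_def X_def R_def by (rule transfer_mat_intertwines[OF inv res j(1) S id])
  also have "j ** w ** j ** (B\<^sup>\<dagger> ** B) ** j ** (P\<^sup>\<dagger> ** R\<^sup>\<dagger> ** X) = (j ** w ** j) ** T ** X"
    by (simp add: T_def matrix_mul_assoc)
  finally show ?thesis
    unfolding jwj by (simp add: X_def[symmetric] matrix_expand matrix_mul_assoc)
qed

section \<open>The differential equations in \<open>x\<close>\<close>

text \<open>Both \<open>S - S\<^sup>\<dagger>\<close> and the defect of the operator identity are locally absolutely continuous, vanish
  at \<open>x0\<close> and have derivative \<open>0\<close> almost everywhere. For the defect, the terms with \<open>c k\<close>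
  cancel after \<open>A R k\<close> and its adjoint are replaced by \<open>1 + c k R k\<close> and its adjoint; what is left
  of \<open>A S' - S' A\<^sup>\<dagger>\<close> is exactly the derivative of \<open>\<i> P j P\<^sup>\<dagger>\<close>.\<close>
lemma operator_identity_preserved:
  fixes A :: "complex^'n^'n" and S :: "real \<Rightarrow> complex^'n^'n" and P :: "real \<Rightarrow> complex^'m^'n"
    and H :: "nat \<Rightarrow> real \<Rightarrow> complex^'m^'m" and c :: "nat \<Rightarrow> real" and K :: "nat set"
  defines "R \<equiv> \<lambda>k. matrix_inv (A - mat (complex_of_real (c k)))"
  assumes I: "is_interval I" "x0 \<in> I" "x \<in> I"
    and res: "\<And>k. k \<in> K \<Longrightarrow> invertible (A - mat (complex_of_real (c k)))"
    and j: "j\<^sup>\<dagger> = j" and H: "\<And>k x. (H k x)\<^sup>\<dagger> = H k x"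
    and acP: "locally_abs_continuous_on I P" and acS: "locally_abs_continuous_on I S"
    and P: "AE x\<in>I in lebesgue. (P has_vector_derivative
           - (\<i> *\<^sub>C (\<Sum>k\<in>K. R k ** P x ** j ** H k x))) (at x within I)"
    and S: "AE x\<in>I in lebesgue. (S has_vector_derivative
           - (\<Sum>k\<in>K. R k ** P x ** j ** H k x ** j ** (P x)\<^sup>\<dagger> ** (R k)\<^sup>\<dagger>)) (at x within I)"
    and id0: "A ** S x0 - S x0 ** A\<^sup>\<dagger> = \<i> *\<^sub>C (P x0 ** j ** (P x0)\<^sup>\<dagger>)"
    and S0: "(S x0)\<^sup>\<dagger> = S x0"
  shows "(S x)\<^sup>\<dagger> = S x"
    and "A ** S x - S x ** A\<^sup>\<dagger> = \<i> *\<^sub>C (P x ** j ** (P x)\<^sup>\<dagger>)"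
proof -
  have "S x - (S x)\<^sup>\<dagger> = S x0 - (S x0)\<^sup>\<dagger>"
  proof (rule locally_abs_continuous_on_zero_derivative_const[OF I(1,3,2)])
    show "locally_abs_continuous_on I (\<lambda>x. S x - (S x)\<^sup>\<dagger>)"
      using acS unfolding locally_abs_continuous_on_def
      by (auto intro!: abs_continuous_on_diff abs_continuous_on_bounded_linear[OF bounded_linear_ctranspose])
    show "AE x\<in>I in lebesgue. ((\<lambda>x. S x - (S x)\<^sup>\<dagger>) has_vector_derivative 0) (at x within I)"
      using S
    proof eventually_elim
      case (elim x)
      show ?case
      proof
        assume "x \<in> I"
        let ?S' = "- (\<Sum>k\<in>K. R k ** P x ** j ** H k x ** j ** (P x)\<^sup>\<dagger> ** (R k)\<^sup>\<dagger>)"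
        have "?S'\<^sup>\<dagger> = ?S'"
          by (simp add: ctranspose_minus ctranspose_sum ctranspose_mult j H matrix_mul_assoc)
        then show "((\<lambda>x. S x - (S x)\<^sup>\<dagger>) has_vector_derivative 0) (at x within I)"
          using has_vector_derivative_diff[OF elim[rule_format, OF \<open>x \<in> I\<close>]
              bounded_linear.has_vector_derivative[OF bounded_linear_ctranspose elim[rule_format, OF \<open>x \<in> I\<close>]]]
          by simp
      qed
    qed
  qed
  then show "(S x)\<^sup>\<dagger> = S x" using S0 by simp
  let ?F = "\<lambda>x. A ** S x - S x ** A\<^sup>\<dagger> - \<i> *\<^sub>C (P x ** j ** (P x)\<^sup>\<dagger>)"
  note bil = bounded_bilinear_matrix_mult
  have "?F x = ?F x0"
  proof (rule locally_abs_continuous_on_zero_derivative_const[OF I(1,3,2)])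
    show "locally_abs_continuous_on I ?F"
      using acS acP unfolding locally_abs_continuous_on_def
      by (auto intro!: abs_continuous_on_diff abs_continuous_on_bounded_linear[OF bounded_linear_cscale]
          abs_continuous_on_bounded_linear[OF bounded_linear_ctranspose]
          abs_continuous_on_bounded_linear[OF bounded_bilinear.bounded_linear_left[OF bil]]
          abs_continuous_on_bounded_linear[OF bounded_bilinear.bounded_linear_right[OF bil]]
          abs_continuous_on_bounded_bilinear[OF bil])
    show "AE x\<in>I in lebesgue. (?F has_vector_derivative 0) (at x within I)"
      using S P
    proof eventually_elim
      case (elim x)
      show ?case
      proof
        assume x: "x \<in> I"
        define T where "T k = R k ** P x ** j ** H k x" for k
        let ?S' = "- (\<Sum>k\<in>K. T k ** j ** (P x)\<^sup>\<dagger> ** (R k)\<^sup>\<dagger>)"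
        let ?P' = "- (\<i> *\<^sub>C (\<Sum>k\<in>K. T k))"
        have S': "(S has_vector_derivative ?S') (at x within I)"
          and P': "(P has_vector_derivative ?P') (at x within I)"
          using elim x by (simp_all add: T_def)
        have summand: "A ** (T k ** j ** (P x)\<^sup>\<dagger> ** (R k)\<^sup>\<dagger>) - (T k ** j ** (P x)\<^sup>\<dagger> ** (R k)\<^sup>\<dagger>) ** A\<^sup>\<dagger>
            = P x ** j ** (T k)\<^sup>\<dagger> - T k ** j ** (P x)\<^sup>\<dagger>" if "k \<in> K" for k
        proof -
          have AR: "A ** R k = mat 1 + complex_of_real (c k) *\<^sub>C R k"
            and RA: "(R k)\<^sup>\<dagger> ** A\<^sup>\<dagger> = mat 1 + complex_of_real (c k) *\<^sub>C (R k)\<^sup>\<dagger>"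
            unfolding R_def
            by (rule resolvent_mult(1)[OF res[OF that]], rule resolvent_ctranspose_mult[OF res[OF that]])
          have "A ** (T k ** j ** (P x)\<^sup>\<dagger> ** (R k)\<^sup>\<dagger>) - (T k ** j ** (P x)\<^sup>\<dagger> ** (R k)\<^sup>\<dagger>) ** A\<^sup>\<dagger>
              = (A ** R k) ** (P x ** j ** H k x) ** j ** (P x)\<^sup>\<dagger> ** (R k)\<^sup>\<dagger>
                - T k ** j ** (P x)\<^sup>\<dagger> ** ((R k)\<^sup>\<dagger> ** A\<^sup>\<dagger>)"
            by (simp add: T_def matrix_mul_assoc)
          also have "\<dots> = P x ** j ** H k x ** j ** (P x)\<^sup>\<dagger> ** (R k)\<^sup>\<dagger> - T k ** j ** (P x)\<^sup>\<dagger>"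
            unfolding AR RA by (simp add: T_def matrix_expand matrix_mul_assoc)
          also have "P x ** j ** H k x ** j ** (P x)\<^sup>\<dagger> ** (R k)\<^sup>\<dagger> = P x ** j ** (T k)\<^sup>\<dagger>"
            by (simp add: T_def ctranspose_mult j H matrix_mul_assoc)
          finally show ?thesis .
        qed
        have "A ** ?S' - ?S' ** A\<^sup>\<dagger> = - (\<Sum>k\<in>K. A ** (T k ** j ** (P x)\<^sup>\<dagger> ** (R k)\<^sup>\<dagger>)
            - (T k ** j ** (P x)\<^sup>\<dagger> ** (R k)\<^sup>\<dagger>) ** A\<^sup>\<dagger>)"
          by (simp add: matrix_mult_uminus_left matrix_mult_uminus_right matrix_mult_sum_left
              matrix_mult_sum_right sum_subtractf)
        also have "\<dots> = - (\<Sum>k\<in>K. P x ** j ** (T k)\<^sup>\<dagger> - T k ** j ** (P x)\<^sup>\<dagger>)"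
          by (simp add: summand)
        also have "\<dots> = \<i> *\<^sub>C (P x ** j ** ?P'\<^sup>\<dagger> + ?P' ** j ** (P x)\<^sup>\<dagger>)"
          by (simp add: ctranspose_minus ctranspose_cscale ctranspose_sum matrix_expand
              matrix_mult_sum_left matrix_mult_sum_right cscale_sum sum_subtractf sum_negf)
        finally have zero: "A ** ?S' - ?S' ** A\<^sup>\<dagger>
            - \<i> *\<^sub>C (P x ** j ** ?P'\<^sup>\<dagger> + ?P' ** j ** (P x)\<^sup>\<dagger>) = 0" by simp
        have "(?F has_vector_derivative A ** ?S' - ?S' ** A\<^sup>\<dagger>
            - \<i> *\<^sub>C (P x ** j ** ?P'\<^sup>\<dagger> + ?P' ** j ** (P x)\<^sup>\<dagger>)) (at x within I)"
          by (intro has_vector_derivative_diff bounded_bilinear.has_vector_derivative[OF bil]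
              bounded_linear.has_vector_derivative[OF bounded_linear_cscale]
              bounded_linear.has_vector_derivative[OF bounded_linear_ctranspose]
              bounded_linear.has_vector_derivative[OF bounded_bilinear.bounded_linear_left[OF bil]]
              bounded_linear.has_vector_derivative[OF bounded_bilinear.bounded_linear_right[OF bil]]
              S' P')
        then show "(?F has_vector_derivative 0) (at x within I)" unfolding zero .
      qed
    qed
  qed
  then show "A ** S x - S x ** A\<^sup>\<dagger> = \<i> *\<^sub>C (P x ** j ** (P x)\<^sup>\<dagger>)" using id0 by simp
qed

theorem theorem4p1:
  fixes r m1 m2 :: nat
    and c :: "nat \<Rightarrow> real"
    and I :: "real set"
    and j :: "complex^('m::{finite,linorder})^('m::{finite,linorder})"
    and \<beta> :: "nat \<Rightarrow> real \<Rightarrow> complex^('m::{finite,linorder})^'p"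
    and H Ht :: "nat \<Rightarrow> real \<Rightarrow> complex^('m::{finite,linorder})^('m::{finite,linorder})"
    and A :: "complex^'n^'n"
    and S :: "real \<Rightarrow> complex^'n^'n"
    and P :: "real \<Rightarrow> complex^('m::{finite,linorder})^'n"
    and \<psi> :: "real \<Rightarrow> (nat \<Rightarrow> real) \<Rightarrow> complex^'n^('m::{finite,linorder})"
  assumes "1 \<le> r"
    and "inj_on c {1..r}"
    and "CARD('m) = m1 + m2"
    and j: "j = sigmat m1"
    and "CARD('p) \<le> CARD('m)"
    and "is_interval I" and "0 \<in> I"
    and H: "\<And>k x. H k x = (\<beta> k x)\<^sup>\<dagger> ** \<beta> k x"
    and "\<And>k. k \<in> {1..r} \<Longrightarrow> locally_summable_on (H k) I"
    and "\<And>k. k \<in> {1..r} \<Longrightarrow> complex_of_real (c k) \<notin> spectrum A"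
    and "A ** S 0 - S 0 ** A\<^sup>\<dagger> = \<i> *\<^sub>C (P 0 ** j ** (P 0)\<^sup>\<dagger>)"
    and "S 0 = (S 0)\<^sup>\<dagger>"
    and "locally_abs_continuous_on I P"
    and "locally_abs_continuous_on I S"
    and "AE x\<in>I in lebesgue. (P has_vector_derivative
           - (\<i> *\<^sub>C (\<Sum>k=1..r. matrix_inv (A - mat (complex_of_real (c k))) ** P x ** j ** H k x)))
           (at x within I)"
    and "AE x\<in>I in lebesgue. (S has_vector_derivative
           - (\<Sum>k=1..r. matrix_inv (A - mat (complex_of_real (c k))) ** P x ** j ** H k x ** j **
                (P x)\<^sup>\<dagger> ** matrix_inv (A\<^sup>\<dagger> - mat (complex_of_real (c k)))))
           (at x within I)"
    and \<psi>: "\<And>x \<zeta>. \<psi> x \<zeta> = psi_tilde j r c A (S x) (P x) \<zeta>"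
    and Ht: "\<And>k x. Ht k x = (beta_tilde j A (S x) (P x) (c k) (\<beta> k x))\<^sup>\<dagger> **
                              beta_tilde j A (S x) (P x) (c k) (\<beta> k x)"
  shows "(\<forall>\<zeta>. locally_abs_continuous_on {x \<in> I. invertible (S x)} (\<lambda>x. \<psi> x \<zeta>)) \<and>
         (AE x\<in>I in lebesgue. invertible (S x) \<longrightarrow>
           (\<forall>\<zeta>. \<exists>D.
              (\<forall>k\<in>{1..r}. ((\<lambda>s. \<psi> x (\<zeta>(k := s))) has_vector_derivative D k) (at (\<zeta> k))) \<and>
              ((\<lambda>y. \<psi> y \<zeta>) has_vector_derivative
                 \<i> *\<^sub>C (\<Sum>k=1..r. j ** Ht k x ** D k)) (at x within I)))"
proof -
  define R where "R k = matrix_inv (A - mat (complex_of_real (c k)))" for k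
  define X where "X x = matrix_inv (S x)" for x
  define E where "E \<zeta> = matexp (\<Sum>k=1..r. \<zeta> k *\<^sub>R R k)" for \<zeta>
  have \<psi>_eq: "\<psi> x \<zeta> = j ** (P x)\<^sup>\<dagger> ** X x ** E \<zeta>" for x \<zeta>
    by (simp add: \<psi> psi_tilde_def X_def E_def R_def)
  have j1: "j\<^sup>\<dagger> = j" and j2: "j ** j = mat 1"
    unfolding j by (rule ctranspose_sigmat, rule sigmat_mult_self)
  have res: "invertible (A - mat (complex_of_real (c k)))" if "k \<in> {1..r}" for k
    using assms(10)[OF that] by (simp add: spectrum_def)
  have Hsym: "(H k x)\<^sup>\<dagger> = H k x" for k x
    by (simp add: H ctranspose_mult)
  have P': "AE x\<in>I in lebesgue. (P has_vector_derivative
      - (\<i> *\<^sub>C (\<Sum>k=1..r. R k ** P x ** j ** H k x))) (at x within I)"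
    using assms(15) by (simp add: R_def)
  have S': "AE x\<in>I in lebesgue. (S has_vector_derivative
      - (\<Sum>k=1..r. R k ** P x ** j ** H k x ** j ** (P x)\<^sup>\<dagger> ** (R k)\<^sup>\<dagger>)) (at x within I)"
    using assms(16) by (simp add: R_def resolvent_ctranspose[OF res])
  note conserved = operator_identity_preserved[OF \<open>is_interval I\<close> \<open>0 \<in> I\<close> _ res j1 Hsym
      assms(13,14) P'[unfolded R_def] S'[unfolded R_def] assms(11) assms(12)[symmetric]]
  have ac: "locally_abs_continuous_on {x \<in> I. invertible (S x)} (\<lambda>x. \<psi> x \<zeta>)" for \<zeta>
    unfolding locally_abs_continuous_on_def
  proof (intro allI impI)
    fix a b assume sub: "{a..b} \<subseteq> {x \<in> I. invertible (S x)}"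
    then have "{a..b} \<subseteq> I" by blast
    then have acP: "abs_continuous_on {a..b} P" and acS: "abs_continuous_on {a..b} S"
      using assms(13,14) by (auto simp: locally_abs_continuous_on_def)
    have acX: "abs_continuous_on {a..b} X"
      unfolding X_def using sub by (intro abs_continuous_on_matrix_inv[OF acS]) auto
    note bil = bounded_bilinear_matrix_mult
    show "abs_continuous_on {a..b} (\<lambda>x. \<psi> x \<zeta>)"
      unfolding \<psi>_eq
      by (intro acX abs_continuous_on_bounded_bilinear[OF bil]
          abs_continuous_on_bounded_linear[OF bounded_bilinear.bounded_linear_left[OF bil]]
          abs_continuous_on_bounded_linear[OF bounded_bilinear.bounded_linear_right[OF bil]]
          abs_continuous_on_bounded_linear[OF bounded_linear_ctranspose acP])
  qed
  have "AE x\<in>I in lebesgue. invertible (S x) \<longrightarrow>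
      (\<forall>\<zeta>. \<exists>D. (\<forall>k\<in>{1..r}. ((\<lambda>s. \<psi> x (\<zeta>(k := s))) has_vector_derivative D k) (at (\<zeta> k))) \<and>
        ((\<lambda>y. \<psi> y \<zeta>) has_vector_derivative \<i> *\<^sub>C (\<Sum>k=1..r. j ** Ht k x ** D k)) (at x within I))"
    using P' S'
  proof eventually_elim
    case (elim x)
    show ?case
    proof (intro impI allI)
      fix \<zeta> assume x: "x \<in> I" and inv: "invertible (S x)"
      define D where "D k = j ** (P x)\<^sup>\<dagger> ** X x ** (R k ** E \<zeta>)" for k
      have D: "((\<lambda>s. \<psi> x (\<zeta>(k := s))) has_vector_derivative D k) (at (\<zeta> k))" if k: "k \<in> {1..r}" for k
      proof -
        \<comment> \<open>Varying \<open>\<zeta>\<^sub>k\<close> moves the exponent along the line \<open>M + s R\<^sub>k\<close>, and the resolvents commute.\<close>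
        define M where "M = (\<Sum>i\<in>{1..r} - {k}. \<zeta> i *\<^sub>R R i)"
        have sum: "(\<Sum>i=1..r. (\<zeta>(k := s)) i *\<^sub>R R i) = M + s *\<^sub>R R k" for s
        proof -
          have "(\<Sum>i=1..r. (\<zeta>(k := s)) i *\<^sub>R R i)
              = (\<zeta>(k := s)) k *\<^sub>R R k + (\<Sum>i\<in>{1..r} - {k}. (\<zeta>(k := s)) i *\<^sub>R R i)"
            by (rule sum.remove) (use k in auto)
          also have "(\<Sum>i\<in>{1..r} - {k}. (\<zeta>(k := s)) i *\<^sub>R R i) = M"
            unfolding M_def by (rule sum.cong) auto
          finally show ?thesis by (simp add: add.commute)
        qed
        have "M ** R k = R k ** M"
          unfolding M_def matrix_mult_sum_left matrix_mult_sum_right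
          by (rule sum.cong) (use k in \<open>auto simp: R_def matrix_mult_scaleR_left matrix_mult_scaleR_right
              resolvents_commute[OF res res]\<close>)
        from has_vector_derivative_matexp[OF this]
        have "((\<lambda>s. E (\<zeta>(k := s))) has_vector_derivative R k ** E (\<zeta>(k := \<zeta> k))) (at (\<zeta> k))"
          unfolding E_def sum .
        from bounded_linear.has_vector_derivative[OF
            bounded_bilinear.bounded_linear_right[OF bounded_bilinear_matrix_mult] this]
        show ?thesis by (simp add: \<psi>_eq D_def)
      qed
      \<comment> \<open>\<open>\<i> T\<^sub>k\<close> is the \<open>k\<close>-th term of the adjoint of \<open>P'\<close>; it is also the right factor in the terms of \<open>S'\<close>.\<close>
      define T where "T k = H k x ** j ** (P x)\<^sup>\<dagger> ** (R k)\<^sup>\<dagger>" for k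
      let ?V = "(P x)\<^sup>\<dagger> ** X x"
      let ?S' = "- (\<Sum>k=1..r. R k ** P x ** j ** H k x ** j ** (P x)\<^sup>\<dagger> ** (R k)\<^sup>\<dagger>)"
      let ?P' = "- (\<i> *\<^sub>C (\<Sum>k=1..r. R k ** P x ** j ** H k x))"
      have X': "(X has_vector_derivative - (X x ** ?S' ** X x)) (at x within I)"
        unfolding X_def using elim x inv by (intro has_vector_derivative_matrix_inv) auto
      have "((\<lambda>y. (P y)\<^sup>\<dagger> ** X y) has_vector_derivative
          (P x)\<^sup>\<dagger> ** (- (X x ** ?S' ** X x)) + ?P'\<^sup>\<dagger> ** X x) (at x within I)"
        using elim x by (intro bounded_bilinear.has_vector_derivative[OF bounded_bilinear_matrix_mult]
            bounded_linear.has_vector_derivative[OF bounded_linear_ctranspose] X') auto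
      also have "(P x)\<^sup>\<dagger> ** (- (X x ** ?S' ** X x)) + ?P'\<^sup>\<dagger> ** X x
          = (\<Sum>k=1..r. \<i> *\<^sub>C T k ** X x + ?V ** R k ** P x ** j ** T k ** X x)"
        by (simp add: T_def ctranspose_minus ctranspose_cscale ctranspose_sum ctranspose_mult j1 Hsym
            matrix_expand matrix_mult_sum_left matrix_mult_sum_right cscale_sum sum.distrib sum_negf
            matrix_mul_assoc)
      also have "\<dots> = (\<Sum>k=1..r. \<i> *\<^sub>C (Ht k x ** j ** ?V ** R k))"
      proof (rule sum.cong[OF refl])
        fix k assume "k \<in> {1..r}"
        from dressed_weight_identity[OF inv res[OF this] j1 j2 conserved[OF x], of "\<beta> k x"]
        show "\<i> *\<^sub>C T k ** X x + ?V ** R k ** P x ** j ** T k ** X x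
            = \<i> *\<^sub>C (Ht k x ** j ** ?V ** R k)"
          by (simp add: T_def H Ht X_def R_def matrix_mul_assoc)
      qed
      finally have "((\<lambda>y. (P y)\<^sup>\<dagger> ** X y) has_vector_derivative
          (\<Sum>k=1..r. \<i> *\<^sub>C (Ht k x ** j ** ?V ** R k))) (at x within I)" .
      from bounded_linear.has_vector_derivative[OF
            bounded_bilinear.bounded_linear_left[OF bounded_bilinear_matrix_mult, of "E \<zeta>"]
          bounded_linear.has_vector_derivative[OF
            bounded_bilinear.bounded_linear_right[OF bounded_bilinear_matrix_mult, of j] this]]
      have "((\<lambda>y. \<psi> y \<zeta>) has_vector_derivative \<i> *\<^sub>C (\<Sum>k=1..r. j ** Ht k x ** D k)) (at x within I)"
        by (simp add: \<psi>_eq D_def matrix_expand matrix_mult_sum_left matrix_mult_sum_right cscale_sum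
            matrix_mul_assoc)
      with D show "\<exists>D. (\<forall>k\<in>{1..r}. ((\<lambda>s. \<psi> x (\<zeta>(k := s))) has_vector_derivative D k) (at (\<zeta> k))) \<and>
        ((\<lambda>y. \<psi> y \<zeta>) has_vector_derivative \<i> *\<^sub>C (\<Sum>k=1..r. j ** Ht k x ** D k)) (at x within I)"
        by blast
    qed
  qed
  with ac show ?thesis by blast
qed

end
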